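(* Let the number $n$ of agents be fixed. Given an allocation instance with $n$ agents and $m$ items in which all valuations $u_i(o)$ are positive integers and $u_i(O)\le V$ for every agent $i$, it is possible to compute an allocation that is utilitarian-maximal within PROP1 in time $O(m^{n+1}V^n)$.
   Context: An allocation instance is a tuple $(N,O,u)$ where $N=\{1,\dots,n\}$ is a set of agents, $O=\{o_1,\dots,o_m\}$ is a set of items, and $u_i(o)$ is agent $i$'s value for item $o$. Utilities are additive: $u_i(O')=\sum_{o\in O'}u_i(o)$ for every $O'\subseteq O$. An allocation is a function $p:N\to 2^O$ with $\bigcup_{i\in N}p(i)=O$ and $p(i)\cap p(j)=\emptyset$ for all $i\ne j$. An allocation $p$ is proportional up to one item (PROP1) if for each $i\in N$ there exists $O'\subseteq O\setminus p(i)$ with $|O'|\le 1$ such that $u_i(p(i)\cup O')\ge u_i(O)/n$. It is utilitarian-maximal within PROP1 if it is PROP1 and maximizes $\sum_{i\in N}u_i(q(i))$ over all PROP1 allocations $q$. Time is measured in elementary operations (unit-cost arithmetic on the integers involved); $n$ is a constant, so the constant hidden in the $O$-notation may depend on $n$. *)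

theory Defs
  imports Complex_Main
begin

section \<open>Allocations\<close>

text \<open>Agents are \<open>{1..n}\<close>, items are \<open>{1..m}\<close>, and \<open>u i j\<close> is the value of item \<open>j\<close> to agent
  \<open>i\<close>. An allocation is a function \<open>nat \<Rightarrow> nat set\<close> of which only the values on \<open>{1..n}\<close> matter.\<close>

definition utility :: "(nat \<Rightarrow> nat \<Rightarrow> int) \<Rightarrow> nat \<Rightarrow> nat set \<Rightarrow> int" where
  "utility u i S = (\<Sum>j\<in>S. u i j)"

definition allocation :: "nat \<Rightarrow> nat \<Rightarrow> (nat \<Rightarrow> nat set) \<Rightarrow> bool" where
  "allocation n m p \<longleftrightarrow>
     (\<Union>i\<in>{1..n}. p i) = {1..m} \<and>
     (\<forall>i\<in>{1..n}. \<forall>j\<in>{1..n}. i \<noteq> j \<longrightarrow> p i \<inter> p j = {})"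

definition PROP1 :: "nat \<Rightarrow> nat \<Rightarrow> (nat \<Rightarrow> nat \<Rightarrow> int) \<Rightarrow> (nat \<Rightarrow> nat set) \<Rightarrow> bool" where
  "PROP1 n m u p \<longleftrightarrow>
     (\<forall>i\<in>{1..n}. \<exists>S. S \<subseteq> {1..m} - p i \<and> card S \<le> 1 \<and>
        real_of_int (utility u i (p i \<union> S)) \<ge> real_of_int (utility u i {1..m}) / real n)"

definition welfare :: "nat \<Rightarrow> (nat \<Rightarrow> nat \<Rightarrow> int) \<Rightarrow> (nat \<Rightarrow> nat set) \<Rightarrow> int" where
  "welfare n u p = (\<Sum>i\<in>{1..n}. utility u i (p i))"

definition utilitarian_maximal_within_PROP1 ::
    "nat \<Rightarrow> nat \<Rightarrow> (nat \<Rightarrow> nat \<Rightarrow> int) \<Rightarrow> (nat \<Rightarrow> nat set) \<Rightarrow> bool" where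
  "utilitarian_maximal_within_PROP1 n m u p \<longleftrightarrow>
     allocation n m p \<and> PROP1 n m u p \<and>
     (\<forall>q. allocation n m q \<and> PROP1 n m u q \<longrightarrow> welfare n u q \<le> welfare n u p)"

section \<open>Programs and their running time\<close>

text \<open>The model of computation is a random access machine on integers, programmed in a structured
  language. A program mentions finitely many integer variables and finitely many arrays; an array
  has one cell for every integer index. Every constant, variable access, array access, addition,
  subtraction, comparison, Boolean connective and assignment costs one unit. Multiplication is not
  primitive: on unbounded integers at unit cost it would make the machine unreasonably powerful,
  while a product with a constant such as the number of agents is a fixed number of additions.\<close>

datatype aexp =
    Const int
  | Var nat
  | Elem nat aexp
  | Plus aexp aexp
  | Minus aexp aexp

datatype bexp =
    Leq aexp aexp
  | Neg bexp
  | Conj bexp bexp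

datatype com =
    Skip
  | Assign nat aexp
  | Store nat aexp aexp
  | Seq com com
  | Cond bexp com com
  | While bexp com

record state =
  vars :: "nat \<Rightarrow> int"
  arrs :: "nat \<Rightarrow> int \<Rightarrow> int"

fun aval :: "aexp \<Rightarrow> state \<Rightarrow> int" where
  "aval (Const c) s = c"
| "aval (Var x) s = vars s x"
| "aval (Elem a e) s = arrs s a (aval e s)"
| "aval (Plus e f) s = aval e s + aval f s"
| "aval (Minus e f) s = aval e s - aval f s"

fun acost :: "aexp \<Rightarrow> nat" where
  "acost (Const c) = 1"
| "acost (Var x) = 1"
| "acost (Elem a e) = acost e + 1"
| "acost (Plus e f) = acost e + acost f + 1"
| "acost (Minus e f) = acost e + acost f + 1"

fun bval :: "bexp \<Rightarrow> state \<Rightarrow> bool" where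
  "bval (Leq e f) s \<longleftrightarrow> aval e s \<le> aval f s"
| "bval (Neg b) s \<longleftrightarrow> \<not> bval b s"
| "bval (Conj b c) s \<longleftrightarrow> bval b s \<and> bval c s"

fun bcost :: "bexp \<Rightarrow> nat" where
  "bcost (Leq e f) = acost e + acost f + 1"
| "bcost (Neg b) = bcost b + 1"
| "bcost (Conj b c) = bcost b + bcost c + 1"

text \<open>\<open>exec c s t s'\<close>: started in \<open>s\<close>, the program \<open>c\<close> halts in \<open>s'\<close> after exactly \<open>t\<close>
  elementary operations.\<close>

inductive exec :: "com \<Rightarrow> state \<Rightarrow> nat \<Rightarrow> state \<Rightarrow> bool" where
  Skip: "exec Skip s 1 s"
| Assign: "exec (Assign x e) s (acost e + 1) (s\<lparr>vars := (vars s)(x := aval e s)\<rparr>)"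
| Store: "exec (Store a e f) s (acost e + acost f + 1)
     (s\<lparr>arrs := (arrs s)(a := (arrs s a)(aval e s := aval f s))\<rparr>)"
| Seq: "exec c s t s' \<Longrightarrow> exec d s' t' s'' \<Longrightarrow> exec (Seq c d) s (t + t') s''"
| CondTrue: "bval b s \<Longrightarrow> exec c s t s' \<Longrightarrow> exec (Cond b c d) s (bcost b + t) s'"
| CondFalse: "\<not> bval b s \<Longrightarrow> exec d s t s' \<Longrightarrow> exec (Cond b c d) s (bcost b + t) s'"
| WhileFalse: "\<not> bval b s \<Longrightarrow> exec (While b c) s (bcost b) s"
| WhileTrue: "bval b s \<Longrightarrow> exec c s t s' \<Longrightarrow> exec (While b c) s' t' s'' \<Longrightarrow>
     exec (While b c) s (bcost b + t + t') s''"

inductive_cases SkipE: "exec Skip s t s'"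
inductive_cases AssignE: "exec (Assign x e) s t s'"
inductive_cases StoreE: "exec (Store a e f) s t s'"
inductive_cases SeqE: "exec (Seq c d) s t s'"
inductive_cases CondE: "exec (Cond b c d) s t s'"
inductive_cases WhileE: "exec (While b c) s t s'"

text \<open>Hence the existence of one terminating run determines the result and the running time.\<close>

lemma exec_deterministic:
  "exec c s t s' \<Longrightarrow> exec c s r z \<Longrightarrow> r = t \<and> z = s'"
proof (induction arbitrary: r z rule: exec.induct)
  case (Seq c s t s' d t' s'')
  then show ?case by (metis SeqE)
next
  case (CondTrue b s c t s' d)
  then show ?case by (metis CondE)
next
  case (CondFalse b s d t s' c)
  then show ?case by (metis CondE)
next
  case (WhileFalse b s c)
  then show ?case by (metis WhileE)
next
  case (WhileTrue b s c t s' t' s'')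
  from WhileTrue.prems WhileTrue.hyps(1) obtain t1 y t2 where
    "exec c s t1 y" "exec (While b c) y t2 z" "r = bcost b + t1 + t2"
    by (metis WhileE)
  with WhileTrue.IH show ?case by metis
qed (auto elim: SkipE AssignE StoreE)

section \<open>Input and output conventions\<close>

text \<open>Variable \<open>0\<close> holds \<open>m\<close>, and array \<open>0\<close> lists the values item by item: \<open>u i j\<close> is in cell
  \<open>(j - 1) * n + (i - 1)\<close>. All other variables and cells are \<open>0\<close>; a bound on the total values is
  not part of the input. The output is read from array \<open>1\<close>, whose cell \<open>j - 1\<close> names the agent
  receiving item \<open>j\<close>.\<close>

definition input_state :: "nat \<Rightarrow> nat \<Rightarrow> (nat \<Rightarrow> nat \<Rightarrow> int) \<Rightarrow> state" where
  "input_state n m u =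
     \<lparr>vars = (\<lambda>x. if x = 0 then int m else 0),
      arrs = (\<lambda>a k. if a = 0 \<and> 0 \<le> k \<and> k < int (n * m)
                    then u (nat k mod n + 1) (nat k div n + 1) else 0)\<rparr>"

definition output_allocation :: "nat \<Rightarrow> state \<Rightarrow> nat \<Rightarrow> nat set" where
  "output_allocation m s i = {j \<in> {1..m}. arrs s 1 (int j - 1) = int i}"

end

theory Submission
  imports Defs
begin

text \<open>Give item \<open>j\<close> to an agent \<open>a\<close> and, at the same time, let the agents of a set \<open>B\<close> with
  \<open>a \<notin> B\<close> use \<open>j\<close> as the extra item that PROP1 grants them. A sequence of such moves, one per
  item, describes a PROP1 allocation iff every agent reaches her proportional share with her bundle
  and extra items together and has used at most one extra item. So it is enough to know, for each
  agent, the value collected so far (at most \<open>V\<close>) and the number of extra items used (at most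
  \<open>m\<close>), and to maximise the welfare over each of the \<open>O(V ^ n * m ^ n)\<close> resulting vectors, which are
  coded as numbers in mixed radix. Processing the \<open>m\<close> items in turn gives \<open>O(m ^ (n + 1) * V ^ n)\<close>.
  A PROP1 allocation exists by a discrete moving knife: a smallest set that satisfies some agent
  leaves, after removal of one item, no agent with more than her share.\<close>

section \<open>Time-bounded total correctness\<close>

text \<open>Guessing the extra items while the items are processed turns PROP1 into a condition on
  the final vector alone. The counters of extra items are not cut off at 1, although larger values
  are useless: with plain counters a move on a given item adds a fixed number to the code, a
  predecessor is found by one subtraction, and the cutoff is tested once at the end. This is where
  the factor \<open>m ^ n\<close> comes from. Two features of the machine shape the rest. It is not
  told \<open>V\<close>, so the radix of the value digits is computed from the input; it is at most
  \<open>2 * n * V\<close> when there are items, and the surplus is a constant in \<open>n\<close>.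
  It cannot multiply, so products of weights and values are looked up in tables of multiples built
  by repeated addition. Loops over agents, digits and moves are unrolled, since their lengths depend
  on \<open>n\<close> only; every remaining loop has a number of rounds known on entry.\<close>

definition runs :: "com \<Rightarrow> state \<Rightarrow> nat \<Rightarrow> (state \<Rightarrow> bool) \<Rightarrow> bool" where
  "runs c s T Q \<longleftrightarrow> (\<exists>t s'. exec c s t s' \<and> t \<le> T \<and> Q s')"

lemma runs_weaken:
  "runs c s T Q \<Longrightarrow> T \<le> T' \<Longrightarrow> (\<And>s'. Q s' \<Longrightarrow> Q' s') \<Longrightarrow> runs c s T' Q'"
  unfolding runs_def by (meson order_trans)

lemma runs_Seq:
  assumes "runs c s T Q" and "\<And>s'. Q s' \<Longrightarrow> runs d s' T' R"
  shows "runs (Seq c d) s (T + T') R"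
  using assms unfolding runs_def by (meson add_mono exec.Seq)

text \<open>The invariant is indexed by the number of finished rounds, so no separate variant is
  needed; the last summand pays for the failing test.\<close>

lemma runs_While:
  assumes "I 0 s"
    and "\<And>k s. k < N \<Longrightarrow> I k s \<Longrightarrow> bval b s \<and> runs c s T (I (Suc k))"
    and "\<And>s. I N s \<Longrightarrow> \<not> bval b s"
  shows "runs (While b c) s (N * (T + bcost b) + bcost b) (I N)"
proof -
  have "runs (While b c) s ((N - k) * (T + bcost b) + bcost b) (I N)" if "k \<le> N" "I k s" for k s
    using that
  proof (induction "N - k" arbitrary: k s)
    case 0
    then have "\<not> bval b s" "I N s" using assms(3) by auto
    then show ?case unfolding runs_def using exec.WhileFalse by fastforce
  next
    case (Suc d)
    then have "k < N" by simp
    with Suc.prems assms(2) have b: "bval b s" and "runs c s T (I (Suc k))" by auto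
    then obtain t s' where c: "exec c s t s'" "t \<le> T" "I (Suc k) s'" unfolding runs_def by auto
    obtain t' s'' where w: "exec (While b c) s' t' s''"
        "t' \<le> (N - Suc k) * (T + bcost b) + bcost b" "I N s''"
      using Suc.hyps(1)[of "Suc k" s'] Suc.hyps(2) c(3) \<open>k < N\<close> unfolding runs_def by force
    have "(N - k) * (T + bcost b) = (T + bcost b) + (N - Suc k) * (T + bcost b)"
      using Suc_diff_Suc[OF \<open>k < N\<close>] by (metis mult_Suc)
    with c(2) w(2) have "bcost b + t + t' \<le> (N - k) * (T + bcost b) + bcost b" by linarith
    with exec.WhileTrue[OF b c(1) w(1)] w(3) show ?case unfolding runs_def by blast
  qed
  from this[of 0 s] assms(1) show ?thesis by simp
qed

fun seqs :: "com list \<Rightarrow> com" where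
  "seqs [] = Skip"
| "seqs (c # cs) = Seq c (seqs cs)"

lemma runs_seqs:
  assumes "I 0 s"
    and "\<And>k s. k < length cs \<Longrightarrow> I k s \<Longrightarrow> runs (cs ! k) s T (I (Suc k))"
  shows "runs (seqs cs) s (length cs * T + 1) (I (length cs))"
  using assms
proof (induction cs arbitrary: I s)
  case Nil
  then show ?case unfolding runs_def using exec.Skip by fastforce
next
  case (Cons c cs)
  have "runs (seqs cs) s' (length cs * T + 1) (I (Suc (length cs)))" if "I (Suc 0) s'" for s'
    using Cons.IH[of "\<lambda>k. I (Suc k)"] Cons.prems(2)[of "Suc _"] that by simp
  moreover have "runs c s T (I (Suc 0))" using Cons.prems by fastforce
  ultimately show ?case using runs_Seq by fastforce
qed

section \<open>Loop-free programs as state transformers\<close>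

fun straight :: "com \<Rightarrow> bool" where
  "straight (Seq c d) \<longleftrightarrow> straight c \<and> straight d"
| "straight (Cond b c d) \<longleftrightarrow> straight c \<and> straight d"
| "straight (While b c) \<longleftrightarrow> False"
| "straight _ \<longleftrightarrow> True"

fun run :: "com \<Rightarrow> state \<Rightarrow> state" where
  "run Skip s = s"
| "run (Assign x e) s = s\<lparr>vars := (vars s)(x := aval e s)\<rparr>"
| "run (Store a e f) s = s\<lparr>arrs := (arrs s)(a := (arrs s a)(aval e s := aval f s))\<rparr>"
| "run (Seq c d) s = run d (run c s)"
| "run (Cond b c d) s = (if bval b s then run c s else run d s)"
| "run (While b c) s = s"

text \<open>Charging both branches of a conditional makes this a bound independent of the state. The
  \<open>While\<close> equations here and in \<open>run\<close> are dummies that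
  \<open>straight\<close> excludes.\<close>

fun cost :: "com \<Rightarrow> nat" where
  "cost Skip = 1"
| "cost (Assign x e) = acost e + 1"
| "cost (Store a e f) = acost e + acost f + 1"
| "cost (Seq c d) = cost c + cost d"
| "cost (Cond b c d) = bcost b + cost c + cost d"
| "cost (While b c) = 0"

lemma exec_straight: "straight c \<Longrightarrow> \<exists>t\<le>cost c. exec c s t (run c s)"
proof (induction c arbitrary: s)
  case (Seq c d)
  then show ?case by simp (meson add_mono exec.Seq)
next
  case (Cond b c d)
  show ?case
  proof (cases "bval b s")
    case True
    from Cond obtain t where "t \<le> cost c" "exec c s t (run c s)" by auto
    with True exec.CondTrue[of b s c t "run c s" d] show ?thesis
      by (intro exI[of _ "bcost b + t"]) auto
  next
    case False
    from Cond obtain t where "t \<le> cost d" "exec d s t (run d s)" by auto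
    with False exec.CondFalse[of b s d t "run d s" c] show ?thesis
      by (intro exI[of _ "bcost b + t"]) auto
  qed
next
  case Skip
  show ?case using exec.Skip by force
next
  case (Assign x e)
  show ?case using exec.Assign by force
next
  case (Store a e f)
  show ?case using exec.Store by force
qed simp

lemma runs_straight: "straight c \<Longrightarrow> Q (run c s) \<Longrightarrow> runs c s (cost c) Q"
  unfolding runs_def using exec_straight by blast

lemma straight_seqs [simp]: "straight (seqs cs) \<longleftrightarrow> (\<forall>c\<in>set cs. straight c)"
  by (induction cs) auto

lemma run_seqs_snoc [simp]: "run (seqs (cs @ [c])) s = run c (run (seqs cs) s)"
  by (induction cs arbitrary: s) auto

definition asum :: "aexp list \<Rightarrow> aexp" where
  "asum es = foldr Plus es (Const 0)"

lemma aval_asum [simp]: "aval (asum es) s = (\<Sum>e\<leftarrow>es. aval e s)"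
  unfolding asum_def by (induction es) auto

definition conjs :: "bexp list \<Rightarrow> bexp" where
  "conjs bs = foldr Conj bs (Leq (Const 0) (Const 0))"

lemma bval_conjs [simp]: "bval (conjs bs) s \<longleftrightarrow> (\<forall>b\<in>set bs. bval b s)"
  unfolding conjs_def by (induction bs) auto

section \<open>Existence of PROP1 allocations\<close>

text \<open>The thresholds stay fixed while agents leave. If an agent leaves with a set
  \<open>B\<close> that no one values above her threshold, one summand \<open>t j\<close> is lost on
  the left of the last assumption and at most \<open>t j\<close> on the right, so it survives for
  the others. The extra item of the leaving agent stays in \<open>R - B\<close> and may later be
  given away.\<close>

lemma share_plus_one_item_exists:
  fixes v :: "'a \<Rightarrow> 'b \<Rightarrow> real"
  assumes "finite A" "A \<noteq> {}" "finite R" "\<And>i j. i \<in> A \<Longrightarrow> j \<in> R \<Longrightarrow> 0 \<le> v i j"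
    and "\<And>i. i \<in> A \<Longrightarrow> 0 \<le> t i" "\<And>i. i \<in> A \<Longrightarrow> real (card A) * t i \<le> sum (v i) R"
  shows "\<exists>p. (\<Union>i\<in>A. p i) = R \<and> (\<forall>i\<in>A. \<forall>j\<in>A. i \<noteq> j \<longrightarrow> p i \<inter> p j = {}) \<and>
    (\<forall>i\<in>A. \<exists>S. S \<subseteq> R - p i \<and> card S \<le> 1 \<and> t i \<le> sum (v i) (p i \<union> S))"
  using assms
proof (induction "card A" arbitrary: A R rule: less_induct)
  case less
  show ?case
  proof (cases "card A = 1")
    case True
    then obtain i where A: "A = {i}" by (auto simp: card_1_singleton_iff)
    then show ?thesis using less.prems(6)[of i]
      by (intro exI[of _ "\<lambda>_. R"]) (auto intro!: exI[of _ "{}"])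
  next
    case False
    let ?P = "\<lambda>S. S \<subseteq> R \<and> (\<exists>i\<in>A. t i \<le> sum (v i) S)"
    have cA: "1 \<le> card A" using less.prems by (simp add: Suc_leI card_gt_0_iff)
    obtain i0 where i0: "i0 \<in> A" using less.prems by blast
    have "1 * t i0 \<le> real (card A) * t i0"
      using cA less.prems(5)[OF i0] by (intro mult_right_mono) auto
    then have "t i0 \<le> sum (v i0) R" using less.prems(6)[OF i0] by simp
    then have "?P R" using i0 by blast
    then obtain S where S: "?P S" and min: "\<And>S'. ?P S' \<Longrightarrow> card S \<le> card S'"
      using ex_has_least_nat[of ?P R card] by auto
    from S obtain i where i: "i \<in> A" "t i \<le> sum (v i) S" by auto
    \<comment> \<open>Minimality of \<open>S\<close> ranges over all agents, so without one item
      \<open>S\<close> satisfies nobody. An empty \<open>S\<close>, possible only for a zero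
      threshold, needs no extra item.\<close>
    have "\<exists>B X. B \<union> X = S \<and> B \<inter> X = {} \<and> card X \<le> 1 \<and> (\<forall>j\<in>A. sum (v j) B \<le> t j)"
    proof (cases "S = {}")
      case True
      then show ?thesis using less.prems(5) by (intro exI[of _ "{}"]) auto
    next
      case False
      then obtain g where g: "g \<in> S" by blast
      have "finite S" using S less.prems(3) finite_subset by blast
      then have "card (S - {g}) < card S" using g by (meson card_Diff1_less)
      then have "\<not> ?P (S - {g})" using min leD by blast
      then have "sum (v j) (S - {g}) \<le> t j" if "j \<in> A" for j using S that by force
      then show ?thesis using g by (intro exI[of _ "S - {g}"] exI[of _ "{g}"]) auto
    qed
    then obtain B X where BX: "B \<union> X = S" "B \<inter> X = {}" "card X \<le> 1"
      and B: "\<And>j. j \<in> A \<Longrightarrow> sum (v j) B \<le> t j" by blast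
    have card: "card (A - {i}) = card A - 1" "card (A - {i}) < card A"
      using i less.prems(1) cA by (auto simp: card_Diff_singleton)
    have "\<exists>p. (\<Union>j\<in>A - {i}. p j) = R - B \<and>
        (\<forall>j\<in>A - {i}. \<forall>k\<in>A - {i}. j \<noteq> k \<longrightarrow> p j \<inter> p k = {}) \<and>
        (\<forall>j\<in>A - {i}. \<exists>S. S \<subseteq> R - B - p j \<and> card S \<le> 1 \<and> t j \<le> sum (v j) (p j \<union> S))"
    proof (rule less.hyps)
      show "A - {i} \<noteq> {}" using card(1) False cA by (metis card.empty diff_is_0_eq le_antisym)
      show "real (card (A - {i})) * t j \<le> sum (v j) (R - B)" if "j \<in> A - {i}" for j
      proof -
        have "sum (v j) (R - B) = sum (v j) R - sum (v j) B"
          using BX S less.prems(3) by (intro sum_diff) auto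
        moreover have "real (card (A - {i})) * t j = real (card A) * t j - t j"
          using card cA by (simp add: algebra_simps)
        ultimately show ?thesis using less.prems(6)[of j] B[of j] that by auto
      qed
    qed (use less.prems card in auto)
    then obtain p where p: "(\<Union>j\<in>A - {i}. p j) = R - B"
        "\<forall>j\<in>A - {i}. \<forall>k\<in>A - {i}. j \<noteq> k \<longrightarrow> p j \<inter> p k = {}"
        "\<forall>j\<in>A - {i}. \<exists>S. S \<subseteq> R - B - p j \<and> card S \<le> 1 \<and> t j \<le> sum (v j) (p j \<union> S)"
      by blast
    let ?q = "p(i := B)"
    have "(\<Union>j\<in>A. ?q j) = B \<union> (\<Union>j\<in>A - {i}. p j)" using i(1) by auto
    then have "(\<Union>j\<in>A. ?q j) = R" using p(1) BX(1) S by auto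
    moreover have "\<forall>j\<in>A. \<forall>k\<in>A. j \<noteq> k \<longrightarrow> ?q j \<inter> ?q k = {}"
    proof (intro ballI impI)
      fix j k assume jk: "j \<in> A" "k \<in> A" "j \<noteq> k"
      have "p l \<inter> B = {}" if "l \<in> A" "l \<noteq> i" for l using p(1) that by blast
      then show "?q j \<inter> ?q k = {}" using p(2) jk by (cases "j = i"; cases "k = i") auto
    qed
    moreover have "\<exists>S. S \<subseteq> R - ?q j \<and> card S \<le> 1 \<and> t j \<le> sum (v j) (?q j \<union> S)" if "j \<in> A" for j
    proof (cases "j = i")
      case True
      then show ?thesis using BX i(2) S by (intro exI[of _ X]) auto
    next
      case False
      then have "\<exists>S. S \<subseteq> R - B - p j \<and> card S \<le> 1 \<and> t j \<le> sum (v j) (p j \<union> S)"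
        using p(3) that by blast
      then show ?thesis using False by auto
    qed
    ultimately show ?thesis by blast
  qed
qed

section \<open>Mixed radix codes of sequences of moves\<close>

lemma mixed_radix_less:
  fixes b d :: "nat \<Rightarrow> nat"
  assumes "\<And>f. f < N \<Longrightarrow> d f < b f"
  shows "(\<Sum>f<N. (\<Prod>g<f. b g) * d f) < (\<Prod>g<N. b g)"
  using assms
proof (induction N)
  case (Suc N)
  let ?w = "\<Prod>g<N. b g"
  have "(\<Sum>f<N. (\<Prod>g<f. b g) * d f) < ?w" using Suc by simp
  moreover have "?w * Suc (d N) \<le> ?w * b N" using Suc.prems by (intro mult_left_mono) (auto simp: Suc_le_eq)
  ultimately show ?case by simp
qed simp

lemma mixed_radix_inj:
  fixes b d e :: "nat \<Rightarrow> nat"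
  assumes "\<And>f. f < N \<Longrightarrow> d f < b f" "\<And>f. f < N \<Longrightarrow> e f < b f"
    and "(\<Sum>f<N. (\<Prod>g<f. b g) * d f) = (\<Sum>f<N. (\<Prod>g<f. b g) * e f)" "f < N"
  shows "d f = e f"
  using assms
proof (induction N)
  case (Suc N)
  let ?w = "\<Prod>g<N. b g"
  let ?d = "\<Sum>f<N. (\<Prod>g<f. b g) * d f" and ?e = "\<Sum>f<N. (\<Prod>g<f. b g) * e f"
  have less: "?d < ?w" "?e < ?w" using Suc.prems by (auto intro!: mixed_radix_less)
  have eq: "?d + ?w * d N = ?e + ?w * e N" using Suc.prems(3) by simp
  from less have "?w > 0" by linarith
  then have "d N = (?d + ?w * d N) div ?w" using less by simp
  also have "\<dots> = e N" unfolding eq using less \<open>?w > 0\<close> by simp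
  finally have "d N = e N" .
  then show ?case using Suc eq by (cases "f = N") auto
qed simp

text \<open>Agents and items are numbered from \<open>0\<close> here. A move is a pair \<open>(a, B)\<close>: the agent receiving
  the item and the agents who use it as their extra item. Digit \<open>f < n\<close> of a code is the value
  collected by agent \<open>f\<close>, extra items included; digit \<open>n + i\<close> is the number of extra items of
  agent \<open>i\<close>.\<close>

locale item_moves =
  fixes n m :: nat and U :: "nat \<Rightarrow> nat \<Rightarrow> nat" and mv :: "(nat \<times> nat set) list"
  assumes n_pos: "1 \<le> n"
    and set_mv: "set mv = {(a, B). a < n \<and> B \<subseteq> {..<n} \<and> a \<notin> B}"
begin

definition gain :: "nat \<Rightarrow> nat \<times> nat set \<Rightarrow> nat \<Rightarrow> nat" where
  "gain f k j = (if f < n then if f = fst k \<or> f \<in> snd k then U f j else 0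
                 else if f - n \<in> snd k then 1 else 0)"

definition score :: "nat \<Rightarrow> (nat \<Rightarrow> nat \<times> nat set) \<Rightarrow> nat \<Rightarrow> nat" where
  "score f \<pi> j = (\<Sum>i<j. gain f (\<pi> i) i)"

definition wel :: "(nat \<Rightarrow> nat \<times> nat set) \<Rightarrow> nat \<Rightarrow> nat" where
  "wel \<pi> j = (\<Sum>i<j. U (fst (\<pi> i)) i)"

definition valid :: "(nat \<Rightarrow> nat \<times> nat set) \<Rightarrow> nat \<Rightarrow> bool" where
  "valid \<pi> j \<longleftrightarrow> (\<forall>i<j. \<pi> i \<in> set mv)"

definition total :: "nat \<Rightarrow> nat" where
  "total i = (\<Sum>j<m. U i j)"

text \<open>One radix for all value digits; a sum is easier to compute than the maximum of the
  totals, and its excess is a factor of at most about \<open>n\<close> per digit.\<close>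

definition W :: nat where
  "W = Suc (\<Sum>i<n. total i)"

definition base :: "nat \<Rightarrow> nat" where
  "base f = (if f < n then W else Suc m)"

definition wt :: "nat \<Rightarrow> nat" where
  "wt f = (\<Prod>g<f. base g)"

abbreviation M :: nat where
  "M \<equiv> wt (2 * n)"

definition code :: "(nat \<Rightarrow> nat \<times> nat set) \<Rightarrow> nat \<Rightarrow> nat" where
  "code \<pi> j = (\<Sum>f<2*n. wt f * score f \<pi> j)"

definition shift :: "nat \<times> nat set \<Rightarrow> nat \<Rightarrow> nat" where
  "shift k j = (\<Sum>f<2*n. wt f * gain f k j)"

lemma wel_Suc [simp]: "wel \<pi> (Suc j) = wel \<pi> j + U (fst (\<pi> j)) j"
  by (simp add: wel_def)

lemma score_Suc [simp]: "score f \<pi> (Suc j) = score f \<pi> j + gain f (\<pi> j) j"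
  by (simp add: score_def)

text \<open>Additivity without carries is what the encoding is for: the only possible predecessor
  code of \<open>r\<close> along a move is \<open>r\<close> minus its \<open>shift\<close>.\<close>

lemma code_Suc [simp]: "code \<pi> (Suc j) = code \<pi> j + shift (\<pi> j) j"
  by (simp add: code_def shift_def algebra_simps sum.distrib)

lemma valid_Suc [simp]: "valid \<pi> (Suc j) \<longleftrightarrow> valid \<pi> j \<and> \<pi> j \<in> set mv"
  by (auto simp: valid_def less_Suc_eq)

lemma start [simp]: "wel \<pi> 0 = 0" "score f \<pi> 0 = 0" "code \<pi> 0 = 0" "valid \<pi> 0"
  by (auto simp: wel_def score_def code_def valid_def)

text \<open>Paths are total functions of which only an initial segment counts, so a path of length
  \<open>j\<close> is extended by an update at \<open>j\<close>.\<close>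

lemma upd_path [simp]:
  assumes "i \<le> j"
  shows "wel (\<pi>(j := k)) i = wel \<pi> i" "score f (\<pi>(j := k)) i = score f \<pi> i"
    "code (\<pi>(j := k)) i = code \<pi> i" "valid (\<pi>(j := k)) i = valid \<pi> i"
  using assms by (auto simp: wel_def score_def code_def valid_def intro!: sum.cong)

lemma total_less_W: "i < n \<Longrightarrow> total i < W"
  unfolding W_def less_Suc_eq_le by (intro member_le_sum) auto

text \<open>Keeps the lookups of \<open>shift_exp\<close> inside the precomputed tables of
  multiples.\<close>

lemma gain_le_base: "f < 2 * n \<Longrightarrow> j < m \<Longrightarrow> gain f k j \<le> base f"
proof -
  assume j: "j < m"
  have "U f j \<le> total f" unfolding total_def using j by (intro member_le_sum) auto
  then show ?thesis using total_less_W[of f] by (auto simp: gain_def base_def)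
qed

lemma score_less_base:
  assumes "f < 2 * n" "j \<le> m"
  shows "score f \<pi> j < base f"
proof (cases "f < n")
  case True
  have "score f \<pi> j \<le> (\<Sum>i<j. U f i)"
    unfolding score_def using True by (intro sum_mono) (auto simp: gain_def)
  also have "\<dots> \<le> total f"
    unfolding total_def using assms by (intro sum_mono2) auto
  finally show ?thesis using total_less_W[OF True] True by (simp add: base_def)
next
  case False
  have "score f \<pi> j \<le> (\<Sum>i<j. 1)"
    unfolding score_def using False by (intro sum_mono) (auto simp: gain_def)
  then show ?thesis using assms False by (simp add: base_def)
qed

lemma code_less: "j \<le> m \<Longrightarrow> code \<pi> j < M"
  unfolding code_def wt_def by (intro mixed_radix_less score_less_base)

lemma code_inj: "code \<pi> m = code \<rho> m \<Longrightarrow> f < 2 * n \<Longrightarrow> score f \<pi> m = score f \<rho> m"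
  unfolding code_def wt_def
  by (rule mixed_radix_inj[where b = base]) (auto intro: score_less_base)

lemma base_pos: "0 < base f"
  by (simp add: base_def W_def)

lemma base_le_M: "f < 2 * n \<Longrightarrow> base f \<le> M"
proof -
  assume f: "f < 2 * n"
  have "base f dvd M" unfolding wt_def using f by (intro dvd_prodI) auto
  moreover have "0 < M" unfolding wt_def using base_pos by (intro prod_pos) auto
  ultimately show ?thesis by (rule dvd_imp_le)
qed

lemma m_less_M: "m < M"
  using base_le_M[of n] n_pos by (simp add: base_def)

lemma M_eq: "M = W ^ n * Suc m ^ n"
proof -
  have "(\<Prod>g<n + q. base g) = (\<Prod>g<n. base g) * (\<Prod>g<q. base (n + g))" for q
    by (induction q) (auto simp: mult_ac)
  from this[of n] have "M = (\<Prod>g<n. base g) * (\<Prod>g<n. base (n + g))"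
    by (simp add: wt_def mult_2)
  then show ?thesis by (simp add: base_def)
qed

text \<open>The proportionality inequality is multiplied by \<open>n\<close> to stay within the
  integers.\<close>

definition good :: "(nat \<Rightarrow> nat \<times> nat set) \<Rightarrow> bool" where
  "good \<pi> \<longleftrightarrow> valid \<pi> m \<and> (\<forall>i<n. total i \<le> n * score i \<pi> m \<and> score (n + i) \<pi> m \<le> 1)"

section \<open>Table cells: soundness and optimality of the entries\<close>

definition pos :: "nat \<Rightarrow> nat \<Rightarrow> int" where
  "pos j r = int (j * M + r)"

text \<open>The table entry for the paths of length \<open>j\<close> with code \<open>r\<close> is in cell \<open>pos j r\<close>: arrays
  \<open>2\<close>, \<open>3\<close>, \<open>4\<close> hold the largest welfare plus one (\<open>0\<close> if there is no such path), the cell of the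
  preceding entry, and the agent (from \<open>1\<close>) receiving the last item; array \<open>10 + 2 * n + f\<close> holds the
  \<open>f\<close>-th digit of \<open>r\<close>.\<close>

definition attained :: "(nat \<Rightarrow> int \<Rightarrow> int) \<Rightarrow> nat \<Rightarrow> nat \<Rightarrow> bool" where
  "attained ar j r \<longleftrightarrow> ar 2 (pos j r) = 0 \<or>
     (\<exists>\<pi>. valid \<pi> j \<and> code \<pi> j = r \<and> ar 2 (pos j r) = int (wel \<pi> j) + 1 \<and>
        (\<forall>i<j. ar 3 (pos (Suc i) (code \<pi> (Suc i))) = pos i (code \<pi> i) \<and>
               ar 4 (pos (Suc i) (code \<pi> (Suc i))) = int (fst (\<pi> i)) + 1) \<and>
        (\<forall>f<2*n. ar (10 + 2 * n + f) (pos j r) = int (score f \<pi> j)))"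

definition dominates :: "(nat \<Rightarrow> int \<Rightarrow> int) \<Rightarrow> nat \<Rightarrow> nat \<Rightarrow> bool" where
  "dominates ar j r \<longleftrightarrow> (\<forall>\<pi>. valid \<pi> j \<and> code \<pi> j = r \<longrightarrow> int (wel \<pi> j) < ar 2 (pos j r))"

text \<open>Optimality while a cell is under construction: \<open>X\<close> contains the last moves
  tried so far.\<close>

definition dominates_via ::
    "(nat \<times> nat set) set \<Rightarrow> (nat \<Rightarrow> int \<Rightarrow> int) \<Rightarrow> nat \<Rightarrow> nat \<Rightarrow> bool" where
  "dominates_via X ar j r \<longleftrightarrow> (\<forall>\<pi>. valid \<pi> (Suc j) \<and> code \<pi> (Suc j) = r \<and> \<pi> j \<in> X \<longrightarrow>
     int (wel \<pi> (Suc j)) < ar 2 (pos (Suc j) r))"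

definition filled :: "(nat \<Rightarrow> int \<Rightarrow> int) \<Rightarrow> nat \<Rightarrow> bool" where
  "filled ar c \<longleftrightarrow> (\<forall>j r. j \<le> m \<and> r < M \<and> j * M + r < c \<longrightarrow> attained ar j r \<and> dominates ar j r)"

text \<open>The chain of preceding cells of an entry lies at or before that entry, so later writes
  cannot damage its witness.\<close>

lemma attained_cong:
  assumes "attained ar j r" "j \<le> m" "r < M"
    and eq: "\<And>a x. (a = 2 \<or> a = 3 \<or> a = 4 \<or> 10 + 2 * n \<le> a) \<Longrightarrow> x \<le> pos j r \<Longrightarrow> ar' a x = ar a x"
  shows "attained ar' j r"
proof (cases "ar 2 (pos j r) = 0")
  case True
  then show ?thesis using eq by (simp add: attained_def)
next
  case False
  then obtain \<pi> where \<pi>: "valid \<pi> j" "code \<pi> j = r" "ar 2 (pos j r) = int (wel \<pi> j) + 1"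
    and tr: "\<forall>i<j. ar 3 (pos (Suc i) (code \<pi> (Suc i))) = pos i (code \<pi> i) \<and>
               ar 4 (pos (Suc i) (code \<pi> (Suc i))) = int (fst (\<pi> i)) + 1"
    and "\<forall>f<2*n. ar (10 + 2 * n + f) (pos j r) = int (score f \<pi> j)"
    using assms(1) unfolding attained_def by blast
  moreover have "pos (Suc i) (code \<pi> (Suc i)) \<le> pos j r" if "i < j" for i
  proof (cases "Suc i = j")
    case True
    then show ?thesis using \<pi>(2) by auto
  next
    case False
    then have "Suc i < j" using that by simp
    then have "Suc i * M + code \<pi> (Suc i) < Suc (Suc i) * M"
      using code_less[of "Suc i" \<pi>] assms(2) by simp
    also have "\<dots> \<le> j * M" using \<open>Suc i < j\<close> by (intro mult_right_mono) auto
    finally show ?thesis unfolding pos_def by linarith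
  qed
  ultimately show ?thesis unfolding attained_def using eq
    by (intro disjI2 exI[of _ \<pi>]) auto
qed

lemma dominates_cong:
  "dominates ar j r \<Longrightarrow> ar' 2 (pos j r) = ar 2 (pos j r) \<Longrightarrow> dominates ar' j r"
  by (simp add: dominates_def)

lemma filled_cong:
  assumes "filled ar c"
    and eq: "\<And>a x. (a = 2 \<or> a = 3 \<or> a = 4 \<or> 10 + 2 * n \<le> a) \<Longrightarrow> x < int c \<Longrightarrow> ar' a x = ar a x"
  shows "filled ar' c"
  unfolding filled_def
proof (intro allI impI conjI; elim conjE)
  fix j r assume r: "j \<le> m" "r < M" "j * M + r < c"
  then have ar: "attained ar j r" "dominates ar j r" using assms(1) by (auto simp: filled_def)
  have "pos j r < int c" using r(3) unfolding pos_def by linarith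
  then show "attained ar' j r" "dominates ar' j r"
    using eq r(1,2) by (auto intro: attained_cong[OF ar(1)] dominates_cong[OF ar(2)])
qed

lemma filled_Suc:
  assumes "filled ar (j * M + r)" "r < M" "attained ar j r" "dominates ar j r"
  shows "filled ar (Suc (j * M + r))"
  unfolding filled_def
proof (intro allI impI)
  fix i s assume is': "i \<le> m \<and> s < M \<and> i * M + s < Suc (j * M + r)"
  show "attained ar i s \<and> dominates ar i s"
  proof (cases "i * M + s = j * M + r")
    case True
    have "i = (i * M + s) div M" using is' by simp
    also have "\<dots> = j" unfolding True using assms(2) by simp
    finally show ?thesis using True assms by simp
  next
    case False
    then show ?thesis using is' assms(1) by (simp add: filled_def)
  qed
qed

lemma dominates_via_all: "dominates_via (set mv) ar j r \<Longrightarrow> dominates ar (Suc j) r"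
  by (auto simp: dominates_via_def dominates_def)

text \<open>A nonzero preceding entry comes with a witness path; updating that path at
  \<open>j\<close> to end with \<open>k\<close> leaves its recorded trace intact.\<close>

lemma candidate:
  assumes "filled ar (Suc j * M + r)" "Suc j \<le> m" "r < M" "shift k j \<le> r"
    and "1 \<le> ar 2 (pos j (r - shift k j))" "k \<in> set mv"
  obtains \<pi> where "valid \<pi> (Suc j)" "code \<pi> (Suc j) = r" "\<pi> j = k"
    "ar 2 (pos j (r - shift k j)) = int (wel \<pi> j) + 1"
    "\<And>i. i < j \<Longrightarrow> ar 3 (pos (Suc i) (code \<pi> (Suc i))) = pos i (code \<pi> i) \<and>
               ar 4 (pos (Suc i) (code \<pi> (Suc i))) = int (fst (\<pi> i)) + 1"
    "\<And>f. f < 2*n \<Longrightarrow> ar (10 + 2 * n + f) (pos j (r - shift k j)) = int (score f \<pi> j)"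
proof -
  let ?r = "r - shift k j"
  have "?r < M" "j * M + ?r < Suc j * M + r" using assms(3) by auto
  then have "attained ar j ?r" using assms(1,2) unfolding filled_def by (meson Suc_leD)
  then obtain \<pi> where \<pi>: "valid \<pi> j" "code \<pi> j = ?r" "ar 2 (pos j ?r) = int (wel \<pi> j) + 1"
      "\<forall>i<j. ar 3 (pos (Suc i) (code \<pi> (Suc i))) = pos i (code \<pi> i) \<and>
               ar 4 (pos (Suc i) (code \<pi> (Suc i))) = int (fst (\<pi> i)) + 1"
      "\<forall>f<2*n. ar (10 + 2 * n + f) (pos j ?r) = int (score f \<pi> j)"
    using assms(5) unfolding attained_def by auto
  show ?thesis
    by (rule that[of "\<pi>(j := k)"]) (use \<pi> assms in \<open>auto simp del: code_Suc\<close>, auto)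
qed

text \<open>A path ending in \<open>k\<close> has a prefix with code \<open>r - shift k j\<close>,
  whose welfare is bounded by the preceding entry. The last premise holds both after rejecting and
  after accepting \<open>k\<close>, so the lemma serves both branches of
  \<open>relax\<close>.\<close>

lemma not_candidate:
  assumes "filled ar (Suc j * M + r)" "Suc j \<le> m" "r < M"
    and "dominates_via X ar j r"
    and "shift k j \<le> r \<Longrightarrow> 1 \<le> ar 2 (pos j (r - shift k j)) \<Longrightarrow>
      ar 2 (pos j (r - shift k j)) + int (U (fst k) j) \<le> ar 2 (pos (Suc j) r)"
  shows "dominates_via (insert k X) ar j r"
  unfolding dominates_via_def
proof (intro allI impI; elim conjE)
  fix \<pi> assume \<pi>: "valid \<pi> (Suc j)" "code \<pi> (Suc j) = r" "\<pi> j \<in> insert k X"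
  show "int (wel \<pi> (Suc j)) < ar 2 (pos (Suc j) r)"
  proof (cases "\<pi> j = k")
    case True
    then have k: "shift k j \<le> r" "code \<pi> j = r - shift k j" using \<pi>(2) by auto
    moreover have "r - shift k j < M" "j * M + (r - shift k j) < Suc j * M + r"
      using assms(3) by auto
    then have "dominates ar j (r - shift k j)"
      using assms(1,2) unfolding filled_def by (meson Suc_leD)
    ultimately have "int (wel \<pi> j) < ar 2 (pos j (r - shift k j))"
      using \<pi>(1) by (auto simp: dominates_def)
    then show ?thesis using assms(5) k True by auto
  next
    case False
    then show ?thesis using assms(4) \<pi> by (auto simp: dominates_via_def)
  qed
qed

end

section \<open>The program\<close>

definition while_less :: "nat \<Rightarrow> aexp \<Rightarrow> com \<Rightarrow> com" where
  "while_less x e c = While (Neg (Leq e (Var x))) c"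

definition incr :: "nat \<Rightarrow> aexp \<Rightarrow> com" where
  "incr x e = Assign x (Plus (Var x) e)"

lemma incr_simps [simp]:
  "run (incr x e) s = s\<lparr>vars := (vars s)(x := vars s x + aval e s)\<rparr>"
  "straight (incr x e)" "cost (incr x e) = acost e + 3"
  by (simp_all add: incr_def)

text \<open>\<open>Y\<close> is a common bound on the rounds of several loops; since it is at least
  1, it also absorbs the final failing test, and the cost becomes a pure multiple of
  \<open>Y\<close>.\<close>

lemma runs_while_less:
  assumes "I 0 s"
    and "\<And>k s. k < N \<Longrightarrow> I k s \<Longrightarrow> runs c s T (I (Suc k))"
    and "\<And>k s. k \<le> N \<Longrightarrow> I k s \<Longrightarrow> vars s x = int k \<and> aval e s = int N"
    and "N \<le> Y" "1 \<le> Y"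
  shows "runs (while_less x e c) s ((T + 2 * (acost e + 3)) * Y) (I N)"
proof -
  let ?b = "Neg (Leq e (Var x))"
  have "runs (While ?b c) s (N * (T + bcost ?b) + bcost ?b) (I N)"
  proof (rule runs_While[where I = I])
    show "bval ?b s \<and> runs c s T (I (Suc k))" if "k < N" "I k s" for k s
      using assms(2,3)[of k s] that by simp
    show "\<not> bval ?b s" if "I N s" for s using assms(3)[of N s] that by simp
  qed (rule assms(1))
  moreover have "N * (T + q) + q \<le> (T + 2 * q) * Y" for q
  proof -
    have "N * (T + q) \<le> Y * (T + q)" using assms(4) by (rule mult_right_mono) simp
    moreover have "1 * q \<le> Y * q" using assms(5) by (rule mult_right_mono) simp
    ultimately have "N * (T + q) + 1 * q \<le> Y * (T + q) + Y * q" by (rule add_mono)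
    also have "\<dots> = (T + 2 * q) * Y" by (simp add: algebra_simps)
    finally show ?thesis by simp
  qed
  moreover have "bcost ?b = acost e + 3" by simp
  ultimately show ?thesis
    unfolding while_less_def by (elim runs_weaken) metis
qed

text \<open>Variable \<open>1\<close> is the current item \<open>j\<close>, \<open>2\<close> is \<open>j * n\<close>, \<open>3\<close> is the radix of the value digits, \<open>4\<close>
  the current weight and finally the number \<open>M\<close> of codes, \<open>5\<close> a counter, \<open>6\<close> the current code, \<open>7\<close> is \<open>j * M\<close>,
  \<open>8\<close> the current cell, \<open>9\<close> and \<open>10\<close> the code and the cell of a preceding entry, \<open>11\<close> and \<open>12\<close> the best value and its
  cell, \<open>20 + i\<close> the total value of agent \<open>i\<close>. Array \<open>10 + f\<close> is the table of the multiples of the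
  weight of digit \<open>f\<close>, which replaces multiplication.\<close>

definition sum_item :: "nat \<Rightarrow> com" where
  "sum_item n = Seq
     (seqs (map (\<lambda>i. incr (20 + i) (Elem 0 (Plus (Var 2) (Const (int i))))) [0..<n]))
     (Seq (incr 1 (Const 1)) (incr 2 (Const (int n))))"

definition base_exp :: "nat \<Rightarrow> nat \<Rightarrow> aexp" where
  "base_exp n f = (if f < n then Var 3 else Plus (Var 0) (Const 1))"

text \<open>Repeated addition starting from the initial 0 in cell 0. The last entry, base times
  weight, is the weight of the next digit, so weights need no multiplication either.\<close>

definition multiples :: "nat \<Rightarrow> nat \<Rightarrow> com" where
  "multiples n f = Seq (Assign 5 (Const 0)) (Seq
     (while_less 5 (base_exp n f)
       (Seq (Store (10 + f) (Plus (Var 5) (Const 1)) (Plus (Elem (10 + f) (Var 5)) (Var 4)))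
         (incr 5 (Const 1))))
     (Assign 4 (Elem (10 + f) (base_exp n f))))"

definition prepare :: "nat \<Rightarrow> com" where
  "prepare n = Seq (while_less 1 (Var 0) (sum_item n))
     (Seq (Seq (Assign 3 (asum (Const 1 # map (\<lambda>i. Var (20 + i)) [0..<n]))) (Assign 4 (Const 1)))
       (seqs (map (multiples n) [0..<2 * n])))"

definition gain_exp :: "nat \<Rightarrow> nat \<Rightarrow> nat \<times> nat set \<Rightarrow> aexp" where
  "gain_exp n f k =
     (if f < n then if f = fst k \<or> f \<in> snd k then Elem 0 (Plus (Var 2) (Const (int f))) else Const 0
      else if f - n \<in> snd k then Const 1 else Const 0)"

definition shift_exp :: "nat \<Rightarrow> nat \<times> nat set \<Rightarrow> aexp" where
  "shift_exp n k = asum (map (\<lambda>f. Elem (10 + f) (gain_exp n f k)) [0..<2 * n])"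

text \<open>The offset by one of stored welfares is inherited from the preceding entry.\<close>

definition welfare_exp :: "nat \<times> nat set \<Rightarrow> aexp" where
  "welfare_exp k = Plus (Elem 2 (Var 10)) (Elem 0 (Plus (Var 2) (Const (int (fst k)))))"

definition record_digits :: "nat \<Rightarrow> nat \<times> nat set \<Rightarrow> com" where
  "record_digits n k = seqs (map (\<lambda>f. Store (10 + 2 * n + f) (Var 8)
     (Plus (Elem (10 + 2 * n + f) (Var 10)) (gain_exp n f k))) [0..<2 * n])"

text \<open>A negative preceding code leads to a read of a meaningless cell; this is harmless
  because arrays are total and the first conjunct fails.\<close>

definition relax :: "nat \<Rightarrow> nat \<times> nat set \<Rightarrow> com" where
  "relax n k = Seq
     (Seq (Assign 9 (Minus (Var 6) (shift_exp n k))) (Assign 10 (Plus (Var 7) (Var 9))))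
     (Cond (Conj (Leq (Const 0) (Var 9)) (Conj (Leq (Const 1) (Elem 2 (Var 10)))
              (Leq (Plus (Elem 2 (Var 8)) (Const 1)) (welfare_exp k))))
       (Seq (Store 2 (Var 8) (welfare_exp k)) (Seq (Store 3 (Var 8) (Var 10))
         (Seq (Store 4 (Var 8) (Const (int (fst k) + 1))) (record_digits n k))))
       Skip)"

definition fill_cell :: "nat \<Rightarrow> (nat \<times> nat set) list \<Rightarrow> com" where
  "fill_cell n mv = Seq (Assign 8 (Plus (Plus (Var 7) (Var 4)) (Var 6)))
     (Seq (seqs (map (relax n) mv)) (incr 6 (Const 1)))"

definition fill_row :: "nat \<Rightarrow> (nat \<times> nat set) list \<Rightarrow> com" where
  "fill_row n mv = Seq (Assign 6 (Const 0)) (Seq (while_less 6 (Var 4) (fill_cell n mv))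
     (Seq (incr 1 (Const 1)) (Seq (incr 2 (Const (int n))) (incr 7 (Var 4)))))"

text \<open>The single nonzero entry of row 0 is the empty path: welfare 0, stored as 1.\<close>

definition fill :: "nat \<Rightarrow> (nat \<times> nat set) list \<Rightarrow> com" where
  "fill n mv = Seq (Seq (Store 2 (Const 0) (Const 1))
       (Seq (Assign 1 (Const 0)) (Seq (Assign 2 (Const 0)) (Assign 7 (Const 0)))))
     (while_less 1 (Var 0) (fill_row n mv))"

text \<open>The product of \<open>n\<close> and a digit is an \<open>n\<close>-fold sum of array
  reads.\<close>

definition good_test :: "nat \<Rightarrow> bexp" where
  "good_test n = conjs (map (\<lambda>i. Conj
      (Leq (Var (20 + i)) (asum (replicate n (Elem (10 + 2 * n + i) (Var 8)))))
      (Leq (Elem (10 + 2 * n + (n + i)) (Var 8)) (Const 1))) [0..<n])"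

text \<open>Variable \<open>11\<close> starts at 0 and only a strictly larger entry replaces it, so
  unreached cells are never chosen.\<close>

definition select_step :: "nat \<Rightarrow> com" where
  "select_step n = Seq (Assign 8 (Plus (Var 7) (Var 6))) (Seq
     (Cond (Conj (Leq (Plus (Var 11) (Const 1)) (Elem 2 (Var 8))) (good_test n))
       (Seq (Assign 11 (Elem 2 (Var 8))) (Assign 12 (Var 8))) Skip)
     (incr 6 (Const 1)))"

definition select :: "nat \<Rightarrow> com" where
  "select n = Seq (Seq (Assign 11 (Const 0)) (Assign 6 (Const 0)))
     (while_less 6 (Var 4) (select_step n))"

definition backtrack_step :: com where
  "backtrack_step = Seq (incr 5 (Const 1)) (Seq (incr 1 (Const (- 1)))
     (Seq (Store 1 (Var 1) (Elem 4 (Var 12))) (Assign 12 (Elem 3 (Var 12)))))"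

definition backtrack :: com where
  "backtrack = Seq (Seq (Assign 5 (Const 0)) (Assign 1 (Var 0))) (while_less 5 (Var 0) backtrack_step)"

definition solver :: "nat \<Rightarrow> (nat \<times> nat set) list \<Rightarrow> com" where
  "solver n mv = Seq (prepare n) (Seq (fill n mv) (Seq (select n) backtrack))"

text \<open>One summand per phase, each to be multiplied by \<open>M * Suc m\<close>. The numerals
  are generous: \<open>102 * n + 15\<close> would do for the preparation.\<close>

definition solver_cost :: "nat \<Rightarrow> (nat \<times> nat set) list \<Rightarrow> nat" where
  "solver_cost n mv = cost (sum_item n) + 203 * n + 20 + (cost (fill_cell n mv) + 100) +
     (cost (select_step n) + 20) + (cost backtrack_step + 20)"

section \<open>Correctness and running time\<close>

context item_moves
begin

section \<open>Preprocessing: totals, radix and multiples\<close>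

definition env :: "state \<Rightarrow> bool" where
  "env s \<longleftrightarrow> vars s 0 = int m \<and> (\<forall>i<n. \<forall>j<m. arrs s 0 (int j * int n + int i) = int (U i j))"

definition totals :: "state \<Rightarrow> nat \<Rightarrow> bool" where
  "totals s j \<longleftrightarrow> (\<forall>i<n. vars s (20 + i) = (\<Sum>l<j. int (U i l)))"

definition tables :: "state \<Rightarrow> nat \<Rightarrow> bool" where
  "tables s f \<longleftrightarrow> (\<forall>g<f. \<forall>x\<le>base g. arrs s (10 + g) (int x) = int (x * wt g))"

definition params :: "state \<Rightarrow> bool" where
  "params s \<longleftrightarrow> env s \<and> totals s m \<and> tables s (2 * n) \<and> vars s 4 = int M"

lemma run_sum_item:
  "run (seqs (map (\<lambda>i. incr (20 + i) (Elem 0 (Plus (Var 2) (Const (int i))))) [0..<N])) s =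
   s\<lparr>vars := \<lambda>x. if 20 \<le> x \<and> x < 20 + N then vars s x + arrs s 0 (vars s 2 + int (x - 20))
                  else vars s x\<rparr>"
proof (induction N)
  case 0
  show ?case by (auto intro!: state.equality)
next
  case (Suc N)
  then show ?case by (auto simp: fun_eq_iff)
qed

definition blank :: "state \<Rightarrow> bool" where
  "blank s \<longleftrightarrow> (\<forall>a x. 0 < a \<longrightarrow> arrs s a x = 0)"

lemma sum_loop:
  assumes "env s" "blank s" "vars s = (\<lambda>x. if x = 0 then int m else 0)" "m \<le> Y" "1 \<le> Y"
  shows "runs (while_less 1 (Var 0) (sum_item n)) s ((cost (sum_item n) + 8) * Y)
    (\<lambda>s. env s \<and> blank s \<and> totals s m)"
proof -
  let ?I = "\<lambda>j s. env s \<and> blank s \<and> totals s j \<and> vars s 1 = int j \<and> vars s 2 = int j * int n"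
  have "runs (while_less 1 (Var 0) (sum_item n)) s ((cost (sum_item n) + 2 * (acost (Var 0) + 3)) * Y)
      (?I m)"
  proof (rule runs_while_less[where I = ?I and N = m])
    show "?I 0 s" using assms by (simp add: totals_def)
    fix j s assume "j < m" "?I j s"
    moreover have "run (sum_item n) s = s\<lparr>vars := (\<lambda>x. if 20 \<le> x \<and> x < 20 + n
        then vars s x + arrs s 0 (vars s 2 + int (x - 20)) else vars s x)
        (1 := vars s 1 + 1, 2 := vars s 2 + int n)\<rparr>"
      by (simp add: sum_item_def run_sum_item)
    ultimately have "?I (Suc j) (run (sum_item n) s)"
      by (auto simp: env_def blank_def totals_def algebra_simps)
    then show "runs (sum_item n) s (cost (sum_item n)) (?I (Suc j))"
      by (intro runs_straight) (auto simp: sum_item_def)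
  qed (use assms in \<open>auto simp: env_def\<close>)
  then show ?thesis by (rule runs_weaken) auto
qed

lemma base_exp:
  "env s \<Longrightarrow> vars s 3 = int W \<Longrightarrow> aval (base_exp n f) s = int (base f)"
  by (simp add: base_exp_def base_def env_def)

text \<open>Arrays from \<open>10 + Suc f\<close> on must remain zero because the next tables start
  from a zero cell; the digit arrays of the path table lie beyond them and are handed over blank as
  well.\<close>

lemma multiples:
  assumes "f < 2 * n" "env s" "totals s m" "tables s f" "vars s 3 = int W" "vars s 4 = int (wt f)"
    and "\<forall>a x. 10 + f \<le> a \<or> 0 < a \<and> a < 10 \<longrightarrow> arrs s a x = 0" "M \<le> Y"
  shows "runs (multiples n f) s (50 * Y)
    (\<lambda>s. env s \<and> totals s m \<and> tables s (Suc f) \<and> vars s 3 = int W \<and> vars s 4 = int (wt (Suc f)) \<and>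
      (\<forall>a x. 10 + Suc f \<le> a \<or> 0 < a \<and> a < 10 \<longrightarrow> arrs s a x = 0))"
proof -
  let ?J = "\<lambda>s. env s \<and> totals s m \<and> tables s f \<and> vars s 3 = int W \<and> vars s 4 = int (wt f) \<and>
      (\<forall>a x. 10 + Suc f \<le> a \<or> 0 < a \<and> a < 10 \<longrightarrow> arrs s a x = 0)"
  let ?I = "\<lambda>k s. ?J s \<and> vars s 5 = int k \<and> (\<forall>x\<le>k. arrs s (10 + f) (int x) = int (x * wt f))"
  let ?c = "Seq (Store (10 + f) (Plus (Var 5) (Const 1)) (Plus (Elem (10 + f) (Var 5)) (Var 4)))
         (incr 5 (Const 1))"
  have Y: "base f \<le> Y" "1 \<le> Y" using base_le_M[OF assms(1)] assms(8) base_pos[of f] by linarith+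
  have 1: "runs (Assign 5 (Const 0)) s (cost (Assign 5 (Const 0))) (?I 0)"
    using assms by (intro runs_straight) (auto simp: env_def totals_def tables_def)
  have 2: "runs (while_less 5 (base_exp n f) ?c) s' ((cost ?c + 2 * (acost (base_exp n f) + 3)) * Y)
      (?I (base f))" if "?I 0 s'" for s'
  proof (rule runs_while_less[where I = ?I and N = "base f"])
    fix k s assume I: "k < base f" "?I k s"
    have "arrs (run ?c s) (10 + f) (int x) = int (x * wt f)" if "x \<le> Suc k" for x
      using I that by (cases "x = Suc k") (auto simp: algebra_simps)
    then have "?I (Suc k) (run ?c s)"
      using I by (auto simp: env_def totals_def tables_def)
    then show "runs ?c s (cost ?c) (?I (Suc k))"
      by (intro runs_straight) auto
  qed (use that Y base_exp in auto)
  have 3: "runs (Assign 4 (Elem (10 + f) (base_exp n f))) s'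
      (cost (Assign 4 (Elem (10 + f) (base_exp n f))))
      (\<lambda>s. env s \<and> totals s m \<and> tables s (Suc f) \<and> vars s 3 = int W \<and> vars s 4 = int (wt (Suc f)) \<and>
      (\<forall>a x. 10 + Suc f \<le> a \<or> 0 < a \<and> a < 10 \<longrightarrow> arrs s a x = 0))" if "?I (base f) s'" for s'
  proof (rule runs_straight)
    have "aval (base_exp n f) s' = int (base f)" using that by (intro base_exp) auto
    then show "env (run (Assign 4 (Elem (10 + f) (base_exp n f))) s') \<and>
      totals (run (Assign 4 (Elem (10 + f) (base_exp n f))) s') m \<and>
      tables (run (Assign 4 (Elem (10 + f) (base_exp n f))) s') (Suc f) \<and>
      vars (run (Assign 4 (Elem (10 + f) (base_exp n f))) s') 3 = int W \<and>
      vars (run (Assign 4 (Elem (10 + f) (base_exp n f))) s') 4 = int (wt (Suc f)) \<and>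
      (\<forall>a x. 10 + Suc f \<le> a \<or> 0 < a \<and> a < 10 \<longrightarrow>
        arrs (run (Assign 4 (Elem (10 + f) (base_exp n f))) s') a x = 0)"
      using that by (auto simp: env_def totals_def tables_def less_Suc_eq wt_def mult_ac)
  qed simp
  have "acost (base_exp n f) \<le> 3" by (simp add: base_exp_def)
  then have "cost ?c + 2 * (acost (base_exp n f) + 3) \<le> 30" by simp
  then have "(cost ?c + 2 * (acost (base_exp n f) + 3)) * Y \<le> 30 * Y" by (rule mult_right_mono) simp
  then have le: "cost (Assign 5 (Const 0)) + ((cost ?c + 2 * (acost (base_exp n f) + 3)) * Y +
      cost (Assign 4 (Elem (10 + f) (base_exp n f)))) \<le> 50 * Y"
    using Y(2) \<open>acost (base_exp n f) \<le> 3\<close> unfolding cost.simps acost.simps by linarith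
  show ?thesis
    unfolding multiples_def
    by (rule runs_weaken[OF runs_Seq[OF 1 runs_Seq[OF 2 3]] le])
qed

lemma sum_list_upt: "(\<Sum>i\<leftarrow>[0..<k]. f i) = (\<Sum>i<k. f i)" for f :: "nat \<Rightarrow> int"
  by (simp add: interv_sum_list_conv_sum_set_nat atLeast0LessThan)

lemma prepare:
  assumes "env s" "blank s" "vars s = (\<lambda>x. if x = 0 then int m else 0)" "M \<le> Y"
  shows "runs (prepare n) s ((cost (sum_item n) + 203 * n + 20) * Y)
    (\<lambda>s. params s \<and> (\<forall>x. arrs s 2 x = 0) \<and> (\<forall>f<2*n. \<forall>x. arrs s (10 + 2 * n + f) x = 0))"
proof -
  let ?I = "\<lambda>f s. env s \<and> totals s m \<and> tables s f \<and> vars s 3 = int W \<and> vars s 4 = int (wt f) \<and>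
      (\<forall>a x. 10 + f \<le> a \<or> 0 < a \<and> a < 10 \<longrightarrow> arrs s a x = 0)"
  let ?c = "Seq (Assign 3 (asum (Const 1 # map (\<lambda>i. Var (20 + i)) [0..<n]))) (Assign 4 (Const 1))"
  have Y: "m \<le> Y" "1 \<le> Y" using m_less_M assms(4) by linarith+
  have 1: "runs ?c s' (cost ?c) (?I 0)" if "env s' \<and> blank s' \<and> totals s' m" for s'
  proof (rule runs_straight)
    show "?I 0 (run ?c s')"
      using that
      by (auto simp: env_def totals_def tables_def blank_def wt_def W_def total_def sum_list_upt comp_def)
  qed simp
  have 2: "runs (seqs (map (multiples n) [0..<2 * n])) s' (2 * n * (50 * Y) + 1) (?I (2 * n))"
    if "?I 0 s'" for s'
  proof -
    have "runs (seqs (map (multiples n) [0..<2 * n])) s'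
      (length (map (multiples n) [0..<2 * n]) * (50 * Y) + 1)
      (?I (length (map (multiples n) [0..<2 * n])))"
      by (rule runs_seqs[where I = ?I]) (use that multiples assms(4) in auto)
    then show ?thesis by simp
  qed
  have "acost (asum (map (\<lambda>i. Var (20 + i)) is)) = 2 * length is + 1" for "is"
    by (induction "is") (auto simp: asum_def)
  from this[of "[0..<n]"] have "cost ?c = 2 * n + 6" by (simp add: asum_def)
  then have "cost ?c + (2 * n * (50 * Y) + 1) = (2 * n + 7) + 100 * n * Y" by simp
  also have "\<dots> \<le> (2 * n + 7) * Y + 100 * n * Y" using Y(2) by (intro add_right_mono) simp
  finally have "(cost (sum_item n) + 8) * Y + (cost ?c + (2 * n * (50 * Y) + 1)) \<le>
      (cost (sum_item n) + 8) * Y + ((2 * n + 7) * Y + 100 * n * Y)"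
    by (rule add_left_mono)
  also have "\<dots> \<le> (cost (sum_item n) + 203 * n + 20) * Y"
    by (simp add: algebra_simps)
  finally have le: "(cost (sum_item n) + 8) * Y + (cost ?c + (2 * n * (50 * Y) + 1)) \<le>
      (cost (sum_item n) + 203 * n + 20) * Y" .
  show ?thesis
    unfolding prepare_def
    by (rule runs_weaken[OF runs_Seq[OF sum_loop[OF assms(1-3) Y] runs_Seq[OF 1 2]] le])
      (auto simp: params_def)
qed

section \<open>Filling the table of paths\<close>

lemma gain_exp:
  "env s \<Longrightarrow> vars s 2 = int j * int n \<Longrightarrow> j < m \<Longrightarrow> aval (gain_exp n f k) s = int (gain f k j)"
  by (simp add: gain_exp_def gain_def env_def)

lemma shift_exp:
  assumes "params s" "vars s 2 = int j * int n" "j < m"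
  shows "aval (shift_exp n k) s = int (shift k j)"
proof -
  have "arrs s (10 + f) (aval (gain_exp n f k) s) = int (wt f * gain f k j)" if "f < 2 * n" for f
  proof -
    have "aval (gain_exp n f k) s = int (gain f k j)"
      using assms by (intro gain_exp) (auto simp: params_def)
    moreover have "gain f k j \<le> base f" using gain_le_base that assms(3) by blast
    ultimately show ?thesis using assms(1) that by (simp add: params_def tables_def mult.commute)
  qed
  then show ?thesis by (simp add: shift_exp_def shift_def sum_list_upt comp_def)
qed

text \<open>Each digit array is written only in its own step, after being read, so all reads can be
  taken in the initial state.\<close>

lemma run_record_digits:
  assumes "env s" "vars s 2 = int j * int n" "j < m"
  shows "run (record_digits n k) s = s\<lparr>arrs := \<lambda>a x.
    if 10 + 2 * n \<le> a \<and> a < 10 + 2 * n + 2 * n \<and> x = vars s 8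
    then arrs s a (vars s 10) + int (gain (a - (10 + 2 * n)) k j) else arrs s a x\<rparr>"
proof -
  have "run (seqs (map (\<lambda>f. Store (10 + 2 * n + f) (Var 8)
      (Plus (Elem (10 + 2 * n + f) (Var 10)) (gain_exp n f k))) [0..<N])) s =
    s\<lparr>arrs := \<lambda>a x. if 10 + 2 * n \<le> a \<and> a < 10 + 2 * n + N \<and> x = vars s 8
    then arrs s a (vars s 10) + int (gain (a - (10 + 2 * n)) k j) else arrs s a x\<rparr>"
    (is "?run N = ?state N") for N
  proof (induction N)
    case 0
    show ?case by (auto intro!: state.equality ext)
  next
    case (Suc N)
    have "aval (gain_exp n N k) (?state N) = int (gain N k j)"
      using assms by (intro gain_exp) (auto simp: env_def)
    then show ?case using Suc by (auto simp: fun_eq_iff)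
  qed
  from this[of "2 * n"] show ?thesis by (simp add: record_digits_def)
qed

lemma straight_record_digits [simp]: "straight (record_digits n k)"
  by (auto simp: record_digits_def)

lemma straight_relax [simp]: "straight (relax n k)"
  by (simp add: relax_def)

lemma pos_less: "i < j \<Longrightarrow> r < M \<Longrightarrow> pos i r < pos j r'"
proof -
  assume "i < j" "r < M"
  then have "i * M + r < Suc i * M" by simp
  also have "\<dots> \<le> j * M" using \<open>i < j\<close> by (intro mult_right_mono) auto
  finally show ?thesis unfolding pos_def by linarith
qed

lemma pos_eq: "pos j r = int j * int M + int r"
  by (simp add: pos_def)

definition cell_inv :: "(nat \<times> nat set) set \<Rightarrow> nat \<Rightarrow> nat \<Rightarrow> state \<Rightarrow> bool" where
  "cell_inv X j t s \<longleftrightarrow> params s \<and> vars s 1 = int j \<and> vars s 2 = int j * int n \<and> vars s 6 = int t \<and>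
     vars s 7 = int j * int M \<and> vars s 8 = pos (Suc j) t \<and> filled (arrs s) (Suc j * M + t) \<and>
     (\<forall>x>pos (Suc j) t. arrs s 2 x = 0) \<and> 0 \<le> arrs s 2 (pos (Suc j) t) \<and>
     attained (arrs s) (Suc j) t \<and> dominates_via X (arrs s) j t"

text \<open>If the move is accepted, the extended witness of the preceding cell becomes the new
  witness; if it is rejected, the entry already dominates every path ending in
  \<open>k\<close>.\<close>

lemma relax:
  assumes inv: "cell_inv X j t s" and j: "j < m" and t: "t < M" and k: "k \<in> set mv"
  shows "cell_inv (insert k X) j t (run (relax n k) s)"
proof -
  let ?c = "pos (Suc j) t" and ?d = "int t - int (shift k j)"
  let ?c' = "int j * int M + ?d"
  let ?s = "s\<lparr>vars := (vars s)(9 := ?d, 10 := ?c')\<rparr>"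
  let ?w = "arrs s 2 ?c' + int (U (fst k) j)"
  let ?C = "shift k j \<le> t \<and> 1 \<le> arrs s 2 ?c' \<and> arrs s 2 ?c + 1 \<le> ?w"
  have p: "params s" and v: "vars s 2 = int j * int n" "vars s 6 = int t"
      "vars s 7 = int j * int M" "vars s 8 = ?c"
    and fill: "filled (arrs s) (Suc j * M + t)" and zero: "\<forall>x>?c. arrs s 2 x = 0"
    and nonneg: "0 \<le> arrs s 2 ?c" and att: "attained (arrs s) (Suc j) t"
    and dom: "dominates_via X (arrs s) j t"
    using inv by (auto simp: cell_inv_def)
  have "fst k < n" using k set_mv by auto
  then have U: "arrs s 0 (int j * int n + int (fst k)) = int (U (fst k) j)"
    using p j by (simp add: params_def env_def)
  have c': "shift k j \<le> t \<Longrightarrow> ?c' = pos j (t - shift k j)" by (simp add: pos_eq of_nat_diff)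
  have run: "run (relax n k) s = (if ?C then run (record_digits n k) (?s\<lparr>arrs :=
      (arrs s)(2 := (arrs s 2)(?c := ?w), 3 := (arrs s 3)(?c := ?c'),
        4 := (arrs s 4)(?c := int (fst k) + 1))\<rparr>) else ?s)"
    using v U shift_exp[OF p v(1) j, of k] by (simp add: relax_def welfare_exp_def)
  show ?thesis
  proof (cases ?C)
    case False
    have "run (relax n k) s = ?s" unfolding run using False by (rule if_not_P)
    moreover have "dominates_via (insert k X) (arrs s) j t"
      using False j t c' by (intro not_candidate[OF fill _ _ dom]) auto
    ultimately show ?thesis
      using inv by (auto simp: cell_inv_def params_def env_def totals_def tables_def)
  next
    case True
    define ar where "ar = arrs (run (relax n k) s)"
    let ?s2 = "?s\<lparr>arrs := (arrs s)(2 := (arrs s 2)(?c := ?w), 3 := (arrs s 3)(?c := ?c'),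
        4 := (arrs s 4)(?c := int (fst k) + 1))\<rparr>"
    have runT: "run (relax n k) s = run (record_digits n k) ?s2"
      unfolding run using True by (rule if_P)
    have "env ?s2" "vars ?s2 2 = int j * int n" using p v by (auto simp: params_def env_def)
    note rd = run_record_digits[OF this j, of k]
    have ar: "ar = (\<lambda>a x. if 10 + 2 * n \<le> a \<and> a < 10 + 2 * n + 2 * n \<and> x = ?c
        then arrs s a ?c' + int (gain (a - (10 + 2 * n)) k j) else arrs ?s2 a x)"
      unfolding ar_def runT rd using v by (auto simp: fun_eq_iff)
    have vars': "vars (run (relax n k) s) = vars ?s" unfolding runT rd by simp
    have new: "ar 2 ?c = ?w" "ar 3 ?c = ?c'" "ar 4 ?c = int (fst k) + 1"
        "\<And>f. f < 2 * n \<Longrightarrow> ar (10 + 2 * n + f) ?c = arrs s (10 + 2 * n + f) ?c' + int (gain f k j)"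
      and old: "\<And>a x. x \<noteq> ?c \<Longrightarrow> ar a x = arrs s a x"
      and other: "\<And>a. a < 2 \<or> 4 < a \<and> a < 10 + 2 * n \<Longrightarrow> ar a = arrs s a"
      by (auto simp: ar fun_eq_iff)
    obtain \<pi> where \<pi>: "valid \<pi> (Suc j)" "code \<pi> (Suc j) = t" "\<pi> j = k"
        "arrs s 2 ?c' = int (wel \<pi> j) + 1"
        "\<And>i. i < j \<Longrightarrow> arrs s 3 (pos (Suc i) (code \<pi> (Suc i))) = pos i (code \<pi> i) \<and>
               arrs s 4 (pos (Suc i) (code \<pi> (Suc i))) = int (fst (\<pi> i)) + 1"
        "\<And>f. f < 2*n \<Longrightarrow> arrs s (10 + 2 * n + f) ?c' = int (score f \<pi> j)"
      using candidate[OF fill _ t _ _ k] j True c' by (metis Suc_leI)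
    have "ar 3 (pos (Suc i) (code \<pi> (Suc i))) = pos i (code \<pi> i) \<and>
          ar 4 (pos (Suc i) (code \<pi> (Suc i))) = int (fst (\<pi> i)) + 1" if "i < Suc j" for i
    proof (cases "i = j")
      case True
      then show ?thesis using new \<pi>(2,3) c' \<open>?C\<close> by auto
    next
      case False
      \<comment> \<open>The earlier part of the trace lies in earlier rows, away from the
        overwritten cell.\<close>
      then have "pos (Suc i) (code \<pi> (Suc i)) < ?c"
        using that j by (intro pos_less code_less) auto
      then show ?thesis using \<pi>(5)[of i] False that by (simp add: old del: code_Suc)
    qed
    then have "attained ar (Suc j) t"
      unfolding attained_def using \<pi> new
      by (intro disjI2 exI[of _ \<pi>]) (auto simp del: code_Suc)
    moreover have fill': "filled ar (Suc j * M + t)"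
      by (rule filled_cong[OF fill]) (auto simp: old pos_def)
    moreover have "dominates_via (insert k X) ar j t"
    proof (rule not_candidate[OF fill'])
      \<comment> \<open>Accepting a move only raises the entry.\<close>
      show "dominates_via X ar j t"
        using dom True new(1) by (fastforce simp: dominates_via_def)
      \<comment> \<open>The preceding cell is in the previous row, so it still holds the value from
        which the new entry was computed.\<close>
      have "t - shift k j < M" using t by simp
      from pos_less[of j "Suc j" "t - shift k j" t, OF lessI this]
      have "pos j (t - shift k j) \<noteq> ?c" by (rule less_imp_neq)
      then show "ar 2 (pos j (t - shift k j)) + int (U (fst k) j) \<le> ar 2 ?c"
        using new(1) c' True old by simp
    qed (use j t in auto)
    moreover have "\<forall>x>?c. ar 2 x = 0" "0 \<le> ar 2 ?c" using zero nonneg True new(1) old by auto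
    moreover have "params (run (relax n k) s)"
      using p other vars' by (simp add: params_def env_def totals_def tables_def flip: ar_def)
    ultimately show ?thesis using inv vars' by (simp add: cell_inv_def flip: ar_def)
  qed
qed

lemma relax_all:
  assumes "cell_inv {} j t s" "j < m" "t < M" "set ks \<subseteq> set mv"
  shows "cell_inv (set ks) j t (run (seqs (map (relax n) ks)) s)"
  using assms(4)
proof (induction ks rule: rev_induct)
  case (snoc k ks)
  then show ?case using relax[of "set ks" j t _ k] assms(2,3) by simp
qed (use assms(1) in simp)

definition row_inv :: "nat \<Rightarrow> nat \<Rightarrow> state \<Rightarrow> bool" where
  "row_inv j t s \<longleftrightarrow> params s \<and> vars s 1 = int j \<and> vars s 2 = int j * int n \<and>
     vars s 7 = int j * int M \<and> filled (arrs s) (Suc j * M + t) \<and> (\<forall>x\<ge>pos (Suc j) t. arrs s 2 x = 0)"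

lemma params_vars:
  "params s \<Longrightarrow> (\<And>x. x \<in> {0, 4} \<or> 20 \<le> x \<Longrightarrow> v x = vars s x) \<Longrightarrow> params (s\<lparr>vars := v\<rparr>)"
  by (simp add: params_def env_def totals_def tables_def)

lemma fill_cell:
  assumes "row_inv j t s" "vars s 6 = int t" "j < m" "t < M"
  shows "row_inv j (Suc t) (run (fill_cell n mv) s) \<and> vars (run (fill_cell n mv) s) 6 = int (Suc t)"
proof -
  let ?s = "s\<lparr>vars := (vars s)(8 := pos (Suc j) t)\<rparr>"
  let ?s' = "run (seqs (map (relax n) mv)) ?s"
  have "vars s 7 + vars s 4 + vars s 6 = pos (Suc j) t"
    using assms(1,2) by (simp add: row_inv_def params_def pos_eq algebra_simps)
  then have run: "run (fill_cell n mv) s = run (incr 6 (Const 1)) ?s'"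
    by (simp add: fill_cell_def)
  \<comment> \<open>The untouched entry is 0, hence attained by convention, and no move has been
    tried yet.\<close>
  have "cell_inv {} j t ?s"
    using assms(1,2)
    by (auto simp: row_inv_def cell_inv_def attained_def dominates_via_def intro!: params_vars)
  then have inv: "cell_inv (set mv) j t ?s'" using assms(3,4) by (intro relax_all) auto
  then have "filled (arrs ?s') (Suc (Suc j * M + t))"
    using assms(3,4) by (intro filled_Suc) (auto simp: cell_inv_def intro: dominates_via_all)
  moreover have "arrs ?s' 2 x = 0" if "x \<ge> pos (Suc j) (Suc t)" for x
    using inv that by (simp add: cell_inv_def pos_eq)
  ultimately show ?thesis
    unfolding run using inv by (auto simp: cell_inv_def row_inv_def intro!: params_vars)
qed

lemma straight_fill_cell [simp]: "straight (fill_cell n mv)"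
  by (simp add: fill_cell_def)

lemma fill_row:
  assumes "row_inv j 0 s" "j < m"
  shows "runs (fill_row n mv) s ((cost (fill_cell n mv) + 30) * M) (row_inv (Suc j) 0)"
proof -
  let ?I = "\<lambda>t s. row_inv j t s \<and> vars s 6 = int t"
  let ?c = "Seq (incr 1 (Const 1)) (Seq (incr 2 (Const (int n))) (incr 7 (Var 4)))"
  have M: "1 \<le> M" using m_less_M by simp
  have 1: "runs (Assign 6 (Const 0)) s (cost (Assign 6 (Const 0))) (?I 0)"
    using assms by (intro runs_straight) (auto simp: row_inv_def intro!: params_vars)
  have 2: "runs (while_less 6 (Var 4) (fill_cell n mv)) s'
      ((cost (fill_cell n mv) + 2 * (acost (Var 4) + 3)) * M) (?I M)" if "?I 0 s'" for s'
  proof (rule runs_while_less[where I = ?I and N = M])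
    fix t s assume "t < M" "?I t s"
    then have "?I (Suc t) (run (fill_cell n mv) s)" using fill_cell assms(2) by blast
    then show "runs (fill_cell n mv) s (cost (fill_cell n mv)) (?I (Suc t))"
      by (intro runs_straight) auto
  qed (use that M in \<open>auto simp: row_inv_def params_def\<close>)
  have 3: "runs ?c s' (cost ?c) (row_inv (Suc j) 0)" if "?I M s'" for s'
  proof (rule runs_straight)
    \<comment> \<open>Rows are contiguous: the cell just past the end of a row starts the next
      one.\<close>
    have "pos (Suc (Suc j)) 0 = pos (Suc j) M" by (simp add: pos_eq algebra_simps)
    moreover have "Suc (Suc j) * M + 0 = Suc j * M + M" by simp
    moreover have "vars s' 4 = int M" using that by (simp add: row_inv_def params_def)
    ultimately show "row_inv (Suc j) 0 (run ?c s')"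
      using that unfolding row_inv_def by (auto simp: algebra_simps intro!: params_vars)
  qed simp
  have "cost (Assign 6 (Const 0)) + ((cost (fill_cell n mv) + 2 * (acost (Var 4) + 3)) * M + cost ?c)
      \<le> (cost (fill_cell n mv) + 30) * M"
    using M by (simp add: add_mult_distrib)
  from runs_weaken[OF runs_Seq[OF 1 runs_Seq[OF 2 3]] this] show ?thesis
    unfolding fill_row_def by blast
qed

definition solved :: "state \<Rightarrow> bool" where
  "solved s \<longleftrightarrow> params s \<and> vars s 7 = int m * int M \<and>
     (\<forall>r<M. attained (arrs s) m r \<and> dominates (arrs s) m r)"

lemma fill:
  assumes "params s" "\<forall>x. arrs s 2 x = 0" "\<forall>f<2*n. \<forall>x. arrs s (10 + 2 * n + f) x = 0"
  shows "runs (fill n mv) s ((cost (fill_cell n mv) + 100) * (M * Suc m)) solved"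
proof -
  let ?K = "(cost (fill_cell n mv) + 30) * M"
  let ?c = "Seq (Store 2 (Const 0) (Const 1))
       (Seq (Assign 1 (Const 0)) (Seq (Assign 2 (Const 0)) (Assign 7 (Const 0))))"
  have 1: "runs ?c s (cost ?c) (row_inv 0 0)"
  proof (rule runs_straight)
    define ar where "ar = arrs (run ?c s)"
    have ar: "ar 2 (pos 0 r) = (if r = 0 then 1 else 0)"
      "f < 2 * n \<Longrightarrow> ar (10 + 2 * n + f) x = 0" for r f x
      using assms by (auto simp: ar_def pos_def)
    \<comment> \<open>At length 0 every function is the same empty path with code 0, so any witness,
      even \<open>undefined\<close>, will do.\<close>
    have "attained ar 0 r" for r
    proof (cases "r = 0")
      case True
      then show ?thesis
        unfolding attained_def using ar by (intro disjI2 exI[of _ undefined]) auto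
    qed (simp add: attained_def ar)
    moreover have "dominates ar 0 r" for r by (auto simp: dominates_def ar)
    moreover have "j = 0" if "j * M + r < M" for j r using that by (cases j) auto
    ultimately have "filled ar (Suc 0 * M + 0)"
      unfolding filled_def by (metis add.right_neutral mult_1 One_nat_def)
    moreover have "\<forall>x\<ge>pos (Suc 0) 0. ar 2 x = 0"
      using assms(2) m_less_M by (auto simp: ar_def pos_def)
    moreover have "params (run ?c s)"
      using assms(1) by (simp add: params_def env_def totals_def tables_def)
    ultimately show "row_inv 0 0 (run ?c s)"
      unfolding row_inv_def ar_def[symmetric] by (intro conjI) (assumption | simp)+
  qed simp
  have 2: "runs (while_less 1 (Var 0) (fill_row n mv)) s' ((?K + 2 * (acost (Var 0) + 3)) * Suc m)
      (row_inv m 0)" if "row_inv 0 0 s'" for s'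
    by (rule runs_while_less[where I = "\<lambda>j. row_inv j 0" and N = m])
      (use that fill_row in \<open>auto simp: row_inv_def params_def env_def\<close>)
  have "1 \<le> M" using m_less_M by simp
  then have "(?K + 8) * Suc m \<le> (?K + 8 * M) * Suc m" "20 * 1 \<le> 20 * (M * Suc m)"
    by (intro mult_right_mono add_left_mono mult_left_mono; simp)+
  moreover have "(?K + 8 * M) * Suc m + 20 * (M * Suc m) \<le>
      (cost (fill_cell n mv) + 100) * (M * Suc m)" by (simp add: algebra_simps)
  ultimately have "cost ?c + (?K + 2 * (acost (Var 0) + 3)) * Suc m \<le>
      (cost (fill_cell n mv) + 100) * (M * Suc m)" by simp
  from runs_weaken[OF runs_Seq[OF 1 2] this, of solved] show ?thesis
    unfolding fill_def by (auto simp: solved_def row_inv_def filled_def)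
qed

section \<open>Selecting the best final cell and tracing its path\<close>

definition good_cell :: "(nat \<Rightarrow> int \<Rightarrow> int) \<Rightarrow> nat \<Rightarrow> bool" where
  "good_cell ar r \<longleftrightarrow> (\<forall>i<n. int (total i) \<le> int n * ar (10 + 2 * n + i) (pos m r) \<and>
     ar (10 + 2 * n + (n + i)) (pos m r) \<le> 1)"

text \<open>The cell may hold the digits of a different path with the same code. Uniqueness of mixed
  radix digits makes them the digits of \<open>\<rho>\<close> too, so the cell passes the
  test.\<close>

lemma good_code:
  assumes "solved s" "good \<rho>"
  shows "good_cell (arrs s) (code \<rho> m)" "int (wel \<rho> m) < arrs s 2 (pos m (code \<rho> m))"
proof -
  have r: "code \<rho> m < M" by (rule code_less) simp
  with assms show less: "int (wel \<rho> m) < arrs s 2 (pos m (code \<rho> m))"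
    by (simp add: solved_def dominates_def good_def)
  have "attained (arrs s) m (code \<rho> m)" using assms(1) r by (simp add: solved_def)
  then obtain \<pi> where \<pi>: "code \<pi> m = code \<rho> m"
      "\<forall>f<2*n. arrs s (10 + 2 * n + f) (pos m (code \<rho> m)) = int (score f \<pi> m)"
    using less unfolding attained_def by force
  have "arrs s (10 + 2 * n + f) (pos m (code \<rho> m)) = int (score f \<rho> m)" if "f < 2 * n" for f
    using \<pi>(2) code_inj[OF \<pi>(1) that] that by simp
  from this[of "_ :: nat"] this[of "n + _"] assms(2) show "good_cell (arrs s) (code \<rho> m)"
    unfolding good_cell_def good_def by (auto simp flip: of_nat_mult)
qed

definition traced :: "(nat \<Rightarrow> int \<Rightarrow> int) \<Rightarrow> (nat \<Rightarrow> nat \<times> nat set) \<Rightarrow> bool" where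
  "traced ar \<pi> \<longleftrightarrow> (\<forall>i<m. ar 3 (pos (Suc i) (code \<pi> (Suc i))) = pos i (code \<pi> i) \<and>
     ar 4 (pos (Suc i) (code \<pi> (Suc i))) = int (fst (\<pi> i)) + 1)"

lemma good_cell_path:
  assumes "solved s" "good_cell (arrs s) r" "r < M" "arrs s 2 (pos m r) \<noteq> 0"
  obtains \<pi> where "good \<pi>" "code \<pi> m = r" "arrs s 2 (pos m r) = int (wel \<pi> m) + 1"
    "traced (arrs s) \<pi>"
proof -
  have "attained (arrs s) m r" using assms(1,3) by (simp add: solved_def)
  then obtain \<pi> where \<pi>: "valid \<pi> m" "code \<pi> m = r" "arrs s 2 (pos m r) = int (wel \<pi> m) + 1"
      "traced (arrs s) \<pi>" "\<And>f. f < 2*n \<Longrightarrow> arrs s (10 + 2 * n + f) (pos m r) = int (score f \<pi> m)"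
    using assms(4) unfolding attained_def traced_def by force
  have "total i \<le> n * score i \<pi> m \<and> score (n + i) \<pi> m \<le> 1" if "i < n" for i
  proof -
    have "int (total i) \<le> int n * int (score i \<pi> m) \<and> int (score (n + i) \<pi> m) \<le> 1"
      using assms(2) that \<pi>(5)[of i] \<pi>(5)[of "n + i"] by (auto simp: good_cell_def)
    then show ?thesis unfolding of_nat_mult[symmetric] by linarith
  qed
  then show ?thesis using \<pi> by (intro that[of \<pi>]) (auto simp: good_def)
qed

lemma straight_select_step [simp]: "straight (select_step n)"
  by (simp add: select_step_def)

lemma solved_vars:
  "solved s \<Longrightarrow> (\<And>x. x \<in> {0, 4, 7} \<or> 20 \<le> x \<Longrightarrow> v x = vars s x) \<Longrightarrow> solved (s\<lparr>vars := v\<rparr>)"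
  by (auto simp: solved_def intro!: params_vars)

lemma good_test:
  assumes "params s" "vars s 8 = pos m r"
  shows "bval (good_test n) s \<longleftrightarrow> good_cell (arrs s) r"
proof -
  have "vars s (20 + i) = int (total i)" if "i < n" for i
    using assms(1) that by (simp add: params_def totals_def total_def)
  then show ?thesis
    using assms(2) by (auto simp: good_test_def good_cell_def sum_list_replicate)
qed

definition best_path :: "(nat \<Rightarrow> nat \<times> nat set) \<Rightarrow> bool" where
  "best_path \<pi> \<longleftrightarrow> good \<pi> \<and> (\<forall>\<rho>. good \<rho> \<longrightarrow> wel \<rho> m \<le> wel \<pi> m)"

lemma select:
  assumes "solved s" "good \<rho>0" "M \<le> Y"
  shows "runs (select n) s ((cost (select_step n) + 20) * Y)
    (\<lambda>s. env s \<and> (\<exists>\<pi>. best_path \<pi> \<and> traced (arrs s) \<pi> \<and> vars s 12 = pos m (code \<pi> m)))"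
proof -
  let ?I = "\<lambda>t s. solved s \<and> vars s 6 = int t \<and> 0 \<le> vars s 11 \<and>
    (\<forall>r<t. good_cell (arrs s) r \<longrightarrow> arrs s 2 (pos m r) \<le> vars s 11) \<and>
    (vars s 11 \<noteq> 0 \<longrightarrow> (\<exists>r<M. good_cell (arrs s) r \<and> arrs s 2 (pos m r) = vars s 11 \<and>
       vars s 12 = pos m r))"
  let ?c = "Seq (Assign 11 (Const 0)) (Assign 6 (Const 0))"
  have Y: "1 \<le> Y" using m_less_M assms(3) by simp
  have 1: "runs ?c s (cost ?c) (?I 0)"
    using assms(1) by (intro runs_straight) (auto intro!: solved_vars)
  have 2: "runs (while_less 6 (Var 4) (select_step n)) s'
      ((cost (select_step n) + 2 * (acost (Var 4) + 3)) * Y) (?I M)" if "?I 0 s'" for s'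
  proof (rule runs_while_less[where I = ?I and N = M])
    fix t s assume t: "t < M" and I: "?I t s"
    let ?s = "s\<lparr>vars := (vars s)(8 := pos m t)\<rparr>"
    let ?s' = "?s\<lparr>vars := (vars ?s)(11 := arrs s 2 (pos m t), 12 := pos m t)\<rparr>"
    have "vars s 7 + vars s 6 = pos m t" using I by (simp add: solved_def pos_eq)
    moreover have "params ?s" using I by (auto simp: solved_def intro!: params_vars)
    then have "bval (good_test n) ?s \<longleftrightarrow> good_cell (arrs s) t" using good_test by simp
    ultimately have run: "run (select_step n) s = run (incr 6 (Const 1))
        (if vars s 11 + 1 \<le> arrs s 2 (pos m t) \<and> good_cell (arrs s) t then ?s' else ?s)"
      by (simp add: select_step_def)
    have "?I (Suc t) (run (select_step n) s)"
    proof (cases "vars s 11 + 1 \<le> arrs s 2 (pos m t) \<and> good_cell (arrs s) t")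
      case True
      then have "\<forall>r<Suc t. good_cell (arrs s) r \<longrightarrow> arrs s 2 (pos m r) \<le> arrs s 2 (pos m t)"
        using I by (fastforce simp: less_Suc_eq)
      moreover have "run (select_step n) s = run (incr 6 (Const 1)) ?s'"
        unfolding run if_P[OF True] ..
      ultimately show ?thesis using I True t by (auto intro!: solved_vars)
    next
      case False
      then have "\<forall>r<Suc t. good_cell (arrs s) r \<longrightarrow> arrs s 2 (pos m r) \<le> vars s 11"
        using I by (fastforce simp: less_Suc_eq)
      moreover have "run (select_step n) s = run (incr 6 (Const 1)) ?s"
        unfolding run if_not_P[OF False] ..
      ultimately show ?thesis using I by (auto intro!: solved_vars)
    qed
    then show "runs (select_step n) s (cost (select_step n)) (?I (Suc t))"
      by (intro runs_straight) auto
  qed (use that assms(3) Y in \<open>auto simp: solved_def params_def\<close>)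
  have 3: "env s' \<and> (\<exists>\<pi>. best_path \<pi> \<and> traced (arrs s') \<pi> \<and> vars s' 12 = pos m (code \<pi> m))"
    if I: "?I M s'" for s'
  proof -
    have le: "int (wel \<rho> m) < vars s' 11" if "good \<rho>" for \<rho>
      using good_code[OF _ that, of s'] I code_less[of m \<rho>] by fastforce
    \<comment> \<open>Here the existence of a good path enters: it guarantees that some cell was
      selected.\<close>
    then have "vars s' 11 \<noteq> 0" using assms(2) by force
    then obtain r where r: "r < M" "good_cell (arrs s') r" "arrs s' 2 (pos m r) = vars s' 11"
        "vars s' 12 = pos m r" using I by blast
    then obtain \<pi> where "good \<pi>" "code \<pi> m = r" "vars s' 11 = int (wel \<pi> m) + 1"
        "traced (arrs s') \<pi>"
      using good_cell_path[of s' r] I \<open>vars s' 11 \<noteq> 0\<close> by metis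
    then have "best_path \<pi> \<and> traced (arrs s') \<pi> \<and> vars s' 12 = pos m (code \<pi> m)"
      using le r(4) by (fastforce simp: best_path_def)
    then show ?thesis using I by (auto simp: solved_def params_def)
  qed
  have le: "cost ?c + (cost (select_step n) + 2 * (acost (Var 4) + 3)) * Y \<le>
      (cost (select_step n) + 20) * Y"
    using Y by (simp add: add_mult_distrib)
  show ?thesis
    unfolding select_def by (rule runs_weaken[OF runs_Seq[OF 1 2] le]) (assumption, rule 3)
qed

lemma backtrack:
  assumes "env s" "traced (arrs s) \<pi>" "vars s 12 = pos m (code \<pi> m)" "m \<le> Y" "1 \<le> Y"
  shows "runs backtrack s ((cost backtrack_step + 20) * Y)
    (\<lambda>s. \<forall>i<m. arrs s 1 (int i) = int (fst (\<pi> i)) + 1)"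
proof -
  let ?I = "\<lambda>k s. vars s 0 = int m \<and> vars s 5 = int k \<and> vars s 1 = int (m - k) \<and>
    traced (arrs s) \<pi> \<and> vars s 12 = pos (m - k) (code \<pi> (m - k)) \<and>
    (\<forall>i<m. m - k \<le> i \<longrightarrow> arrs s 1 (int i) = int (fst (\<pi> i)) + 1)"
  let ?c = "Seq (Assign 5 (Const 0)) (Assign 1 (Var 0))"
  have 1: "runs ?c s (cost ?c) (?I 0)"
    using assms by (intro runs_straight) (auto simp: env_def)
  have 2: "runs (while_less 5 (Var 0) backtrack_step) s'
      ((cost backtrack_step + 2 * (acost (Var 0) + 3)) * Y) (?I m)" if "?I 0 s'" for s'
  proof (rule runs_while_less[where I = ?I and N = m])
    fix k :: nat and s :: state assume k: "k < m" and I: "?I k s"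
    define i where "i = m - Suc k"
    have mk: "m - k = Suc i" "i < m" using k by (auto simp: i_def)
    have tr: "arrs s 3 (pos (Suc i) (code \<pi> (Suc i))) = pos i (code \<pi> i)"
        "arrs s 4 (pos (Suc i) (code \<pi> (Suc i))) = int (fst (\<pi> i)) + 1"
      using I mk(2) by (auto simp: traced_def simp del: code_Suc)
    have "run backtrack_step s = s\<lparr>
        arrs := (arrs s)(1 := (arrs s 1)(int i := int (fst (\<pi> i)) + 1)),
        vars := (vars s)(5 := int k + 1, 1 := int i, 12 := pos i (code \<pi> i))\<rparr>"
      using I tr mk by (simp add: backtrack_step_def del: code_Suc)
    then have "?I (Suc k) (run backtrack_step s)"
      using I mk by (auto simp: traced_def Suc_le_eq i_def[symmetric] simp del: code_Suc)
    then show "runs backtrack_step s (cost backtrack_step) (?I (Suc k))"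
      by (intro runs_straight) (auto simp: backtrack_step_def)
  qed (use that assms in auto)
  have "cost ?c + (cost backtrack_step + 2 * (acost (Var 0) + 3)) * Y \<le> (cost backtrack_step + 20) * Y"
    using assms(5) by (simp add: add_mult_distrib)
  from runs_weaken[OF runs_Seq[OF 1 2] this,
      of "\<lambda>s. \<forall>i<m. arrs s 1 (int i) = int (fst (\<pi> i)) + 1"] show ?thesis
    unfolding backtrack_def by simp
qed

lemma solver:
  assumes "env s" "blank s" "vars s = (\<lambda>x. if x = 0 then int m else 0)" "good \<rho>"
  shows "runs (solver n mv) s (solver_cost n mv * (M * Suc m))
    (\<lambda>s. \<exists>\<pi>. best_path \<pi> \<and> (\<forall>i<m. arrs s 1 (int i) = int (fst (\<pi> i)) + 1))"
proof -
  let ?Y = "M * Suc m"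
  have "1 \<le> M" using m_less_M by simp
  then have "1 * Suc m \<le> ?Y" by (rule mult_right_mono) simp
  then have Y: "M \<le> ?Y" "m \<le> ?Y" "1 \<le> ?Y" by auto
  have 4: "runs backtrack s' ((cost backtrack_step + 20) * ?Y)
      (\<lambda>s. \<exists>\<pi>. best_path \<pi> \<and> (\<forall>i<m. arrs s 1 (int i) = int (fst (\<pi> i)) + 1))"
    if "env s' \<and> (\<exists>\<pi>. best_path \<pi> \<and> traced (arrs s') \<pi> \<and> vars s' 12 = pos m (code \<pi> m))" for s'
  proof -
    from that obtain \<pi> where "env s'" "best_path \<pi>" "traced (arrs s') \<pi>"
      "vars s' 12 = pos m (code \<pi> m)" by blast
    then show ?thesis by (intro runs_weaken[OF backtrack[OF _ _ _ Y(2,3)]]) auto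
  qed
  have 2: "runs (fill n mv) s' ((cost (fill_cell n mv) + 100) * ?Y) solved"
    if "params s' \<and> (\<forall>x. arrs s' 2 x = 0) \<and> (\<forall>f<2*n. \<forall>x. arrs s' (10 + 2 * n + f) x = 0)" for s'
    using that by (intro fill) auto
  have "runs (solver n mv) s ((cost (sum_item n) + 203 * n + 20) * ?Y +
      ((cost (fill_cell n mv) + 100) * ?Y + ((cost (select_step n) + 20) * ?Y +
        (cost backtrack_step + 20) * ?Y)))
    (\<lambda>s. \<exists>\<pi>. best_path \<pi> \<and> (\<forall>i<m. arrs s 1 (int i) = int (fst (\<pi> i)) + 1))"
    unfolding solver_def
    by (rule runs_Seq[OF prepare[OF assms(1-3) Y(1)]
          runs_Seq[OF 2 runs_Seq[OF select[OF _ assms(4) Y(1)] 4]]])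
  then show ?thesis
    by (rule runs_weaken) (simp_all add: solver_cost_def add_mult_distrib)
qed

subsection \<open>Sequences of moves and allocations\<close>

text \<open>With \<open>Suc\<close> on the left, the set for index 0 is empty, so
  \<open>share\<close> agrees with \<open>output_allocation\<close> at every index.\<close>

definition share :: "(nat \<Rightarrow> nat \<times> nat set) \<Rightarrow> nat \<Rightarrow> nat set" where
  "share \<pi> i = {j \<in> {1..m}. Suc (fst (\<pi> (j - 1))) = i}"

text \<open>Meaningful for \<open>i\<close> at least 1; truncated subtraction makes index 0 repeat
  agent 1.\<close>

definition bonus :: "(nat \<Rightarrow> nat \<times> nat set) \<Rightarrow> nat \<Rightarrow> nat set" where
  "bonus \<pi> i = {j \<in> {1..m}. i - 1 \<in> snd (\<pi> (j - 1))}"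

lemma valid_fst: "valid \<pi> m \<Longrightarrow> j < m \<Longrightarrow> fst (\<pi> j) < n \<and> fst (\<pi> j) \<notin> snd (\<pi> j)"
  using set_mv by (fastforce simp: valid_def)

lemma share_allocation: "valid \<pi> m \<Longrightarrow> allocation n m (share \<pi>)"
proof -
  assume v: "valid \<pi> m"
  have "\<exists>i\<in>{1..n}. j \<in> share \<pi> i" if "j \<in> {1..m}" for j
  proof -
    have "j - 1 < m" using that by auto
    then show ?thesis
      using valid_fst[OF v, of "j - 1"] that
      by (intro bexI[of _ "Suc (fst (\<pi> (j - 1)))"]) (auto simp: share_def)
  qed
  then show ?thesis by (auto simp: allocation_def share_def)
qed

lemma score_bonus: "i < n \<Longrightarrow> score (n + i) \<pi> m = card (bonus \<pi> (Suc i))"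
proof -
  have "card (bonus \<pi> (Suc i)) = (\<Sum>j\<in>{1..m}. if i \<in> snd (\<pi> (j - 1)) then 1 else 0)"
    unfolding bonus_def card_eq_sum by (subst sum.inter_filter) auto
  then show ?thesis by (simp add: score_def gain_def sum.atLeast1_atMost_eq)
qed

context
  fixes u :: "nat \<Rightarrow> nat \<Rightarrow> int"
  assumes u: "\<And>i j. i < n \<Longrightarrow> j < m \<Longrightarrow> u (Suc i) (Suc j) = int (U i j)"
begin

lemma utility_filter:
  "i < n \<Longrightarrow> utility u (Suc i) {j \<in> {1..m}. P j} = (\<Sum>j<m. if P (Suc j) then int (U i j) else 0)"
proof -
  assume i: "i < n"
  have "utility u (Suc i) {j \<in> {1..m}. P j} = (\<Sum>j\<in>{1..m}. if P j then u (Suc i) j else 0)"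
    unfolding utility_def by (rule sum.inter_filter) simp
  also have "\<dots> = (\<Sum>j<m. if P (Suc j) then u (Suc i) (Suc j) else 0)"
    by (simp add: sum.atLeast1_atMost_eq)
  also have "\<dots> = (\<Sum>j<m. if P (Suc j) then int (U i j) else 0)"
    using u i by (intro sum.cong) auto
  finally show ?thesis .
qed

lemma utility_total: "i < n \<Longrightarrow> utility u (Suc i) {1..m} = int (total i)"
proof -
  assume i: "i < n"
  have "{j \<in> {1..m}. True} = {1..m}" by blast
  with utility_filter[OF i, of "\<lambda>_. True"] show ?thesis by (simp only: total_def of_nat_sum if_True)
qed

lemma score_utility:
  assumes "i < n"
  shows "int (score i \<pi> m) = utility u (Suc i) (share \<pi> (Suc i) \<union> bonus \<pi> (Suc i))"
proof -
  have "share \<pi> (Suc i) \<union> bonus \<pi> (Suc i) =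
      {j \<in> {1..m}. i = fst (\<pi> (j - 1)) \<or> i \<in> snd (\<pi> (j - 1))}"
    by (auto simp: share_def bonus_def)
  then show ?thesis
    using utility_filter[OF assms] assms by (auto simp: score_def gain_def intro!: sum.cong)
qed

lemma welfare_share:
  assumes "valid \<pi> m"
  shows "welfare n u (share \<pi>) = int (wel \<pi> m)"
proof -
  have "welfare n u (share \<pi>) = (\<Sum>i<n. utility u (Suc i) (share \<pi> (Suc i)))"
    unfolding welfare_def by (simp add: sum.atLeast1_atMost_eq)
  also have "\<dots> = (\<Sum>i<n. \<Sum>j<m. if fst (\<pi> j) = i then int (U i j) else 0)"
    unfolding share_def using utility_filter by (intro sum.cong) auto
  also have "\<dots> = (\<Sum>j<m. \<Sum>i<n. if fst (\<pi> j) = i then int (U i j) else 0)"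
    by (rule sum.swap)
  also have "\<dots> = (\<Sum>j<m. int (U (fst (\<pi> j)) j))"
    using valid_fst[OF assms] by (intro sum.cong) auto
  finally show ?thesis by (simp add: wel_def)
qed

lemma fraction_iff:
  "real_of_int x \<ge> real_of_int y / real n \<longleftrightarrow> y \<le> int n * x"
proof -
  have "real_of_int x \<ge> real_of_int y / real n \<longleftrightarrow> real_of_int y \<le> real_of_int (int n * x)"
    using n_pos by (simp add: field_simps)
  then show ?thesis by (simp only: of_int_le_iff)
qed

text \<open>The recipient of an item is never among its extra users, so \<open>bonus\<close> avoids
  \<open>share\<close> and serves as the set required by PROP1.\<close>

lemma good_PROP1:
  assumes "good \<pi>"
  shows "PROP1 n m u (share \<pi>)"
  unfolding PROP1_def fraction_iff
proof
  fix i assume "i \<in> {1..n}"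
  then obtain i' where i: "i = Suc i'" "i' < n" by (cases i) auto
  have v: "valid \<pi> m" using assms by (simp add: good_def)
  have "bonus \<pi> i \<subseteq> {1..m} - share \<pi> i"
    using valid_fst[OF v] i by (fastforce simp: bonus_def share_def)
  moreover have "total i' \<le> n * score i' \<pi> m" "score (n + i') \<pi> m \<le> 1"
    using assms i(2) by (auto simp: good_def)
  then have "int (total i') \<le> int n * int (score i' \<pi> m)" "card (bonus \<pi> i) \<le> 1"
    using i score_bonus by (auto simp flip: of_nat_mult)
  then have "utility u i {1..m} \<le> int n * utility u i (share \<pi> i \<union> bonus \<pi> i)"
    and "card (bonus \<pi> i) \<le> 1"
    unfolding i(1) score_utility[OF i(2)] utility_total[OF i(2)] .
  ultimately show "\<exists>S\<subseteq>{1..m} - share \<pi> i. card S \<le> 1 \<and>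
      utility u i {1..m} \<le> int n * utility u i (share \<pi> i \<union> S)" by blast
qed

text \<open>Fix an extra set for each agent. The move for an item consists of its owner and of the
  agents whose extra set contains it; several agents may name the same item.\<close>

lemma PROP1_good:
  assumes "allocation n m q" "PROP1 n m u q"
  obtains \<pi> where "good \<pi>" "welfare n u q = int (wel \<pi> m)"
proof -
  from assms(2) obtain S where S: "\<And>i. i \<in> {1..n} \<Longrightarrow> S i \<subseteq> {1..m} - q i"
      "\<And>i. i \<in> {1..n} \<Longrightarrow> card (S i) \<le> 1"
      "\<And>i. i \<in> {1..n} \<Longrightarrow> utility u i {1..m} \<le> int n * utility u i (q i \<union> S i)"
    unfolding PROP1_def fraction_iff by metis
  have ex: "\<exists>i<n. Suc j \<in> q (Suc i)" if "j < m" for j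
  proof -
    have "Suc j \<in> (\<Union>i\<in>{1..n}. q i)" using assms(1) that by (simp add: allocation_def)
    then obtain i where "i \<in> {1..n}" "Suc j \<in> q i" by blast
    then show ?thesis by (intro exI[of _ "i - 1"]) auto
  qed
  define a where "a j = (SOME i. i < n \<and> Suc j \<in> q (Suc i))" for j
  have a: "a j < n \<and> Suc j \<in> q (Suc (a j))" if "j < m" for j
    unfolding a_def by (rule someI_ex[OF ex[OF that]])
  define \<pi> where "\<pi> = (\<lambda>j. (a j, {i. i < n \<and> Suc j \<in> S (Suc i)}))"
  have "\<pi> j \<in> set mv" if "j < m" for j
  proof -
    have "Suc j \<notin> S (Suc (a j))" using a[OF that] S(1)[of "Suc (a j)"] by auto
    then show ?thesis using a[OF that] unfolding set_mv \<pi>_def by auto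
  qed
  then have v: "valid \<pi> m" by (simp add: valid_def)
  have sub: "q (Suc i) \<subseteq> {1..m}" if "i < n" for i
    using assms(1) that by (fastforce simp: allocation_def)
  have share: "share \<pi> (Suc i) = q (Suc i)" if i: "i < n" for i
  proof -
    have "Suc (a (j - 1)) = Suc i \<longleftrightarrow> j \<in> q (Suc i)" if "j \<in> {1..m}" for j
    proof -
      have "a (j - 1) < n" "j \<in> q (Suc (a (j - 1)))" using a[of "j - 1"] that by auto
      moreover have "q (Suc i) \<inter> q (Suc (a (j - 1))) = {}" if "Suc i \<noteq> Suc (a (j - 1))"
        using assms(1) i \<open>a (j - 1) < n\<close> that unfolding allocation_def
        by (metis Suc_leI atLeastAtMost_iff le_add1 plus_1_eq_Suc)
      ultimately show ?thesis by fastforce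
    qed
    then show ?thesis using sub[OF i] by (auto simp: share_def \<pi>_def)
  qed
  have bonus: "bonus \<pi> (Suc i) = S (Suc i)" if "i < n" for i
    using S(1)[of "Suc i"] that by (auto simp: bonus_def \<pi>_def)
  have "total i \<le> n * score i \<pi> m \<and> score (n + i) \<pi> m \<le> 1" if i: "i < n" for i
  proof -
    have "int (total i) \<le> int n * int (score i \<pi> m)"
      using S(3)[of "Suc i"] i score_utility[OF i] utility_total[OF i] share bonus by simp
    moreover have "score (n + i) \<pi> m \<le> 1"
      using S(2)[of "Suc i"] i score_bonus[OF i] bonus by simp
    ultimately show ?thesis by (simp flip: of_nat_mult)
  qed
  then have "good \<pi>" using v by (simp add: good_def)
  moreover have "welfare n u q = welfare n u (share \<pi>)"
    unfolding welfare_def One_nat_def sum.atLeast1_atMost_eq using share by (intro sum.cong) auto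
  ultimately show ?thesis using that welfare_share[OF v] by metis
qed

lemma best_path_maximal: "best_path \<pi> \<Longrightarrow> utilitarian_maximal_within_PROP1 n m u (share \<pi>)"
proof -
  assume \<pi>: "best_path \<pi>"
  then have g: "good \<pi>" and v: "valid \<pi> m" by (auto simp: best_path_def good_def)
  have "welfare n u q \<le> welfare n u (share \<pi>)" if q: "allocation n m q" "PROP1 n m u q" for q
  proof -
    obtain \<rho> where "good \<rho>" "welfare n u q = int (wel \<rho> m)" using PROP1_good[OF q] .
    then show ?thesis using \<pi> welfare_share[OF v] by (auto simp: best_path_def)
  qed
  then show ?thesis
    using g v share_allocation good_PROP1
    by (auto simp: utilitarian_maximal_within_PROP1_def)
qed

text \<open>The thresholds are the proportional shares, for which \<open>n\<close> times the
  threshold is exactly the total value.\<close>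

lemma good_exists: "\<exists>\<pi>. good \<pi>"
proof -
  let ?v = "\<lambda>i j. real_of_int (u i j)"
  let ?t = "\<lambda>i. real_of_int (utility u i {1..m}) / real n"
  have nonneg: "0 \<le> u i j" if "i \<in> {1..n}" "j \<in> {1..m}" for i j
    using u[of "i - 1" "j - 1"] that by auto
  then have "0 \<le> utility u i {1..m}" if "i \<in> {1..n}" for i
    using that unfolding utility_def by (intro sum_nonneg) auto
  then have t: "0 \<le> ?t i" if "i \<in> {1..n}" for i using that by simp
  then have "\<exists>p. (\<Union>i\<in>{1..n}. p i) = {1..m} \<and>
    (\<forall>i\<in>{1..n}. \<forall>j\<in>{1..n}. i \<noteq> j \<longrightarrow> p i \<inter> p j = {}) \<and>
    (\<forall>i\<in>{1..n}. \<exists>S. S \<subseteq> {1..m} - p i \<and> card S \<le> 1 \<and> ?t i \<le> sum (?v i) (p i \<union> S))"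
    using nonneg n_pos by (intro share_plus_one_item_exists t) (auto simp: utility_def)
  then obtain p where "allocation n m p" "PROP1 n m u p"
    unfolding allocation_def PROP1_def utility_def of_int_sum by blast
  then show ?thesis using PROP1_good by metis
qed

end

end

(* For m >= 1 the hypotheses force V >= 1, so the maximum with 1 only affects m = 0. *)
theorem theorem7p2:
  fixes n :: nat
  assumes "n \<ge> 1"
  shows "\<exists>(P :: com) (C :: nat). \<forall>(m :: nat) (V :: nat) (u :: nat \<Rightarrow> nat \<Rightarrow> int).
    (\<forall>i\<in>{1..n}. \<forall>j\<in>{1..m}. u i j > 0) \<and> (\<forall>i\<in>{1..n}. utility u i {1..m} \<le> int V) \<longrightarrow>
    (\<exists>t s. exec P (input_state n m u) t s \<and>
       t \<le> C * max 1 (m ^ (n + 1) * V ^ n) \<and>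
       utilitarian_maximal_within_PROP1 n m u (output_allocation m s))"
proof -
  let ?moves = "{(a, B). a < n \<and> B \<subseteq> {..<n} \<and> a \<notin> B}"
  have "finite ?moves"
    by (rule finite_subset[of _ "{..<n} \<times> Pow {..<n}"]) auto
  from finite_list[OF this] obtain mv where mv: "set mv = ?moves" ..
  show ?thesis
  \<comment> \<open>For at least one item, \<open>W\<close> is at most \<open>2 * n * V\<close> and
    \<open>Suc m\<close> at most \<open>2 * m\<close>; the constant collects what these estimates
    add to \<open>M * Suc m\<close>.\<close>
  proof (rule exI[of _ "solver n mv"],
      rule exI[of _ "solver_cost n mv * ((2 * n) ^ n * 2 ^ n * 2)"],
      intro allI impI, elim conjE)
    fix m V :: nat and u :: "nat \<Rightarrow> nat \<Rightarrow> int"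
    assume pos: "\<forall>i\<in>{1..n}. \<forall>j\<in>{1..m}. u i j > 0"
      and V: "\<forall>i\<in>{1..n}. utility u i {1..m} \<le> int V"
    define U where "U i j = nat (u (Suc i) (Suc j))" for i j
    interpret item_moves n m U mv using assms mv by unfold_locales
    have u: "u (Suc i) (Suc j) = int (U i j)" if "i < n" "j < m" for i j
      using pos that by (simp add: U_def less_imp_le)
    obtain \<rho> where \<rho>: "good \<rho>" using good_exists[OF u] by blast
    have "arrs (input_state n m u) 0 (int j * int n + int i) = int (U i j)"
      if "i < n" "j < m" for i j
    proof -
      have "Suc j * n \<le> m * n" using that by (intro mult_right_mono) auto
      then have "j * n + i < n * m" using that by (simp add: mult.commute)
      then have "int (j * n + i) < int (n * m)" by (rule of_nat_less_iff[THEN iffD2])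
      moreover have "int j * int n + int i = int (j * n + i)" by simp
      moreover have "(j * n + i) mod n = i" "(j * n + i) div n = j" using that by auto
      ultimately show ?thesis
        using u[OF that] unfolding input_state_def by (simp del: of_nat_add of_nat_mult)
    qed
    then have "env (input_state n m u)" by (simp add: env_def input_state_def)
    moreover have "blank (input_state n m u)"
      "vars (input_state n m u) = (\<lambda>x. if x = 0 then int m else 0)"
      by (auto simp: blank_def input_state_def)
    ultimately have "runs (solver n mv) (input_state n m u) (solver_cost n mv * (M * Suc m))
      (\<lambda>s. \<exists>\<pi>. best_path \<pi> \<and> (\<forall>i<m. arrs s 1 (int i) = int (fst (\<pi> i)) + 1))"
      using solver \<rho> by simp
    then obtain t s \<pi> where ex: "exec (solver n mv) (input_state n m u) t s"
        "t \<le> solver_cost n mv * (M * Suc m)"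
      and \<pi>: "best_path \<pi>" "\<forall>i<m. arrs s 1 (int i) = int (fst (\<pi> i)) + 1"
      unfolding runs_def by blast
    have "output_allocation m s i = share \<pi> i" for i
    proof -
      have "arrs s 1 (int j - 1) = int i \<longleftrightarrow> Suc (fst (\<pi> (j - 1))) = i" if "j \<in> {1..m}" for j
      proof -
        have "j - 1 < m" "int (j - 1) = int j - 1" using that by auto
        with \<pi>(2) have "arrs s 1 (int j - 1) = int (fst (\<pi> (j - 1))) + 1" by metis
        then show ?thesis by linarith
      qed
      then show ?thesis by (auto simp: output_allocation_def share_def)
    qed
    then have "output_allocation m s = share \<pi>" by blast
    then have "utilitarian_maximal_within_PROP1 n m u (output_allocation m s)"
      using best_path_maximal[OF u \<pi>(1)] by simp
    moreover have "M * Suc m \<le> (2 * n) ^ n * 2 ^ n * 2 * max 1 (m ^ (n + 1) * V ^ n)"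
    proof (cases "m = 0")
      case True
      \<comment> \<open>Without items there is a single code, even when \<open>V\<close> is
        0.\<close>
      then have "W = 1" unfolding W_def total_def by simp
      then have "M * Suc m = 1" unfolding M_eq using True by simp
      moreover have "1 \<le> (2 * n) ^ n * 2 ^ n * 2 * max 1 (m ^ (n + 1) * V ^ n)"
        using assms by simp
      ultimately show ?thesis by simp
    next
      case False
      have tot: "total i \<le> V" if "i < n" for i
        using V[rule_format, of "Suc i"] utility_total[OF u that] that by simp
      \<comment> \<open>A positive value of one item forces \<open>V\<close> to be at least 1, which
        absorbs the summand 1 of \<open>W\<close>.\<close>
      have "U 0 0 \<le> total 0" unfolding total_def using False by (intro member_le_sum) auto
      moreover have "0 < U 0 0" using u[of 0 0] pos assms False by force
      ultimately have "1 \<le> V" using tot[of 0] assms by linarith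
      have "(\<Sum>i<n. total i) \<le> (\<Sum>i<n. V)" using tot by (intro sum_mono) auto
      then have "W \<le> 1 + n * V" by (simp add: W_def)
      moreover have "1 * 1 \<le> n * V" using assms \<open>1 \<le> V\<close> by (rule mult_le_mono)
      ultimately have W: "W \<le> 2 * n * V" by linarith
      have "M * Suc m \<le> ((2 * n * V) ^ n * (2 * m) ^ n) * (2 * m)"
        unfolding M_eq using W False by (intro mult_le_mono power_mono) auto
      also have "\<dots> = (2 * n) ^ n * 2 ^ n * 2 * (m ^ (n + 1) * V ^ n)"
        by (simp add: power_mult_distrib)
      also have "\<dots> \<le> (2 * n) ^ n * 2 ^ n * 2 * max 1 (m ^ (n + 1) * V ^ n)"
        by (intro mult_left_mono) auto
      finally show ?thesis .
    qed
    from order_trans[OF ex(2) mult_le_mono2[OF this]]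
    have "t \<le> solver_cost n mv * ((2 * n) ^ n * 2 ^ n * 2) * max 1 (m ^ (n + 1) * V ^ n)"
      by (simp only: mult.assoc)
    ultimately show "\<exists>t s. exec (solver n mv) (input_state n m u) t s \<and>
       t \<le> solver_cost n mv * ((2 * n) ^ n * 2 ^ n * 2) * max 1 (m ^ (n + 1) * V ^ n) \<and>
       utilitarian_maximal_within_PROP1 n m u (output_allocation m s)"
      using ex(1) by blast
  qed
qed

end
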